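(* Let $n\ge8$ be a multiple of $4$. (i) Every nonempty shell of $W_n$ and of $\mathrm{Sh}(W_n)$ is a spherical $3$-design. (ii) Every nonempty shell of $W_8$ is a spherical $7$-design. (iii) Every nonempty shell of $W_{16}$ is a spherical $3\tfrac12$-design.
   Context: For $n$ a positive multiple of $4$, $W_n=\{x\in\mathbb R^n: 2x_i\in\mathbb Z,\ x_i-x_1\in\mathbb Z\ \forall i,\ \sum_ix_i\in2\mathbb Z\}$; it is selfdual, even if $n\equiv0\pmod8$ and odd otherwise. Its shadow is $\mathrm{Sh}(W_n)=W_n$ if $n\equiv 0\pmod 8$, and for $n\equiv4\pmod8$, $\mathrm{Sh}(W_n)=\{x: 2x_i\in\mathbb Z,\ x_i-x_1\in\mathbb Z\ \forall i,\ \sum_ix_i\in2\mathbb Z+1\}$. Shell of norm $m$: $A_m=\{x\in A:\langle x,x\rangle=m\}$. Designs (antipodal sets): $(C_{2j})$ means $\sum_{x\in X}P(x)=0$ for every homogeneous harmonic polynomial $P$ of degree $2j$; $X$ is a spherical $t$-design iff $(C_{2j})$ holds for all $2\le2j\le t$; a spherical $(2s+1+\tfrac12)$-design satisfies $(C_{2j})$ for $2\le2j\le2s$ and for $2j=2s+4$ (so a $3\tfrac12$-design satisfies $(C_2)$ and $(C_6)$). *)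

theory Defs
  imports Complex_Main
begin

text \<open>Vectors of R^n are represented as functions nat => real supported on {..<n}
  (coordinate i-1 of the paper is index i here, i < n).\<close>

definition vecs :: "nat \<Rightarrow> (nat \<Rightarrow> real) set" where
  "vecs n = {x. \<forall>i\<ge>n. x i = 0}"

definition W :: "nat \<Rightarrow> (nat \<Rightarrow> real) set" where
  "W n = {x \<in> vecs n. (\<forall>i<n. 2 * x i \<in> \<int> \<and> x i - x 0 \<in> \<int>)
                        \<and> (\<exists>k::int. (\<Sum>i<n. x i) = 2 * of_int k)}"

definition ShW :: "nat \<Rightarrow> (nat \<Rightarrow> real) set" where
  "ShW n = (if n mod 8 = 0 then W n else
     {x \<in> vecs n. (\<forall>i<n. 2 * x i \<in> \<int> \<and> x i - x 0 \<in> \<int>)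
                 \<and> (\<exists>k::int. (\<Sum>i<n. x i) = 2 * of_int k + 1)})"

definition inner_n :: "nat \<Rightarrow> (nat \<Rightarrow> real) \<Rightarrow> (nat \<Rightarrow> real) \<Rightarrow> real" where
  "inner_n n x y = (\<Sum>i<n. x i * y i)"

definition shell :: "nat \<Rightarrow> (nat \<Rightarrow> real) set \<Rightarrow> real \<Rightarrow> (nat \<Rightarrow> real) set" where
  "shell n A m = {x \<in> A. inner_n n x x = m}"

definition exps :: "nat \<Rightarrow> nat \<Rightarrow> (nat \<Rightarrow> nat) set" where
  "exps n d = {\<alpha>. (\<forall>i\<ge>n. \<alpha> i = 0) \<and> (\<Sum>i<n. \<alpha> i) = d}"

definition hpoly_eval :: "nat \<Rightarrow> nat \<Rightarrow> ((nat \<Rightarrow> nat) \<Rightarrow> real) \<Rightarrow> (nat \<Rightarrow> real) \<Rightarrow> real" where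
  "hpoly_eval n d c x = (\<Sum>\<alpha>\<in>exps n d. c \<alpha> * (\<Prod>i<n. x i ^ \<alpha> i))"

text \<open>Harmonic: the Laplacian (computed coefficientwise) vanishes.  The coefficient of
  x^beta in the Laplacian of sum_alpha c_alpha x^alpha is
  sum_i (beta_i+2)(beta_i+1) c_{beta + 2 e_i}.\<close>

definition harmonic_hpoly :: "nat \<Rightarrow> nat \<Rightarrow> ((nat \<Rightarrow> nat) \<Rightarrow> real) \<Rightarrow> bool" where
  "harmonic_hpoly n d c \<longleftrightarrow> 2 \<le> d \<and>
     (\<forall>\<beta>\<in>exps n (d - 2).
        (\<Sum>i<n. real ((\<beta> i + 2) * (\<beta> i + 1)) * c (\<beta>(i := \<beta> i + 2))) = 0)"

definition cond_C :: "nat \<Rightarrow> nat \<Rightarrow> (nat \<Rightarrow> real) set \<Rightarrow> bool" where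
  "cond_C n d X \<longleftrightarrow> (\<forall>c. harmonic_hpoly n d c \<longrightarrow> (\<Sum>x\<in>X. hpoly_eval n d c x) = 0)"

text \<open>Spherical t-design for antipodal sets: (C_{2j}) for 2 <= 2j <= t.\<close>

definition spherical_design :: "nat \<Rightarrow> nat \<Rightarrow> (nat \<Rightarrow> real) set \<Rightarrow> bool" where
  "spherical_design n t X \<longleftrightarrow> (\<forall>j. 2 \<le> 2*j \<and> 2*j \<le> t \<longrightarrow> cond_C n (2*j) X)"

text \<open>Spherical (2s+1+1/2)-design: (C_{2j}) for 2 <= 2j <= 2s and for 2j = 2s+4.\<close>

definition spherical_half_design :: "nat \<Rightarrow> nat \<Rightarrow> (nat \<Rightarrow> real) set \<Rightarrow> bool" where
  "spherical_half_design n s X \<longleftrightarrow>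
     (\<forall>j. 2 \<le> 2*j \<and> 2*j \<le> 2*s \<longrightarrow> cond_C n (2*j) X) \<and> cond_C n (2*s+4) X"

end

theory Submission
  imports Defs "HOL-Combinatorics.Permutations"
begin

text \<open>All the shells are invariant under permutations and under sign changes of two coordinates, so
  a moment with an odd exponent vanishes and $(C_2)$, $(C_4)$, $(C_6)$ become linear relations between
  the moments of $x_0^4$, $x_0^2 x_1^2$ and of $x_0^6$, $x_0^4 x_1^2$, $x_0^2 x_1^2 x_2^2$; $(C_2)$ holds trivially.

  Split the coordinates into blocks of four. On a block, the reflection in $(1/2,1/2,1/2,1/2)$ and the change
  of one sign permute the three nontrivial cosets of the root lattice $D_4$ in its dual (triality).
  Reflecting both blocks at once preserves $W_8$; comparing the moments of $x_0^4$ and $x_0^6$ before and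
  after, together with the constancy of the norm, gives the relations for $n = 8$.

  For $W_{16}$, take the harmonic sextic on the first block that is invariant under triality. Both
  $W_{16}$ and $W_8 \oplus W_8$ are unions of cosets of $D_4^4$, and the words describing these cosets
  have the same distribution of zero patterns. Hence by triality in each block the sextic has the same sum
  over a shell of $W_{16}$ as over the corresponding shell of $W_8 \oplus W_8$, where it is zero by the
  case $n = 8$.\<close>

section \<open>Moments and harmonic polynomials\<close>

definition moment :: "(nat \<Rightarrow> real) set \<Rightarrow> nat \<Rightarrow> (nat \<Rightarrow> nat) \<Rightarrow> real" where
  "moment X n \<alpha> = (\<Sum>x\<in>X. \<Prod>i<n. x i ^ \<alpha> i)"

lemma finite_exps: "finite (exps n d)"
proof (rule finite_subset)
  show "exps n d \<subseteq> {\<alpha>. \<forall>i. (i \<in> {..<n} \<longrightarrow> \<alpha> i \<in> {..d}) \<and> (i \<notin> {..<n} \<longrightarrow> \<alpha> i = 0)}"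
    by (auto simp: exps_def intro: member_le_sum)
  show "finite {\<alpha>. \<forall>i. (i \<in> {..<n} \<longrightarrow> \<alpha> i \<in> {..d}) \<and> (i \<notin> {..<n} \<longrightarrow> \<alpha> i = (0::nat))}"
    by (rule finite_set_of_finite_funs) auto
qed

lemma sum_fun_upd_nat:
  fixes \<alpha> :: "nat \<Rightarrow> nat"
  assumes "i < n"
  shows "(\<Sum>j<n. (\<alpha>(i := k)) j) + \<alpha> i = (\<Sum>j<n. \<alpha> j) + k"
proof -
  have "(\<Sum>j\<in>{..<n} - {i}. (\<alpha>(i := k)) j) = (\<Sum>j\<in>{..<n} - {i}. \<alpha> j)"
    by (rule sum.cong) auto
  then show ?thesis
    using assms by (simp add: sum.remove[of "{..<n}" i])
qed

text \<open>A functional on monomials kills the harmonic polynomials as soon as it lies in the image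
  of the transpose of the Laplacian.\<close>

lemma cond_C_transpose_laplacian:
  assumes eq: "\<And>\<alpha>. \<alpha> \<in> exps n d \<Longrightarrow>
      moment X n \<alpha> = (\<Sum>i<n. real (\<alpha> i * (\<alpha> i - 1)) * N (\<alpha>(i := \<alpha> i - 2)))"
  shows "cond_C n d X"
  unfolding cond_C_def
proof (intro allI impI)
  fix c assume H: "harmonic_hpoly n d c"
  then have d: "2 \<le> d" by (simp add: harmonic_hpoly_def)
  \<comment> \<open>The Laplacian is moved from \<open>c\<close> to \<open>N\<close> one variable at
    a time: with e_i the i-th unit exponent, \<beta> = \<alpha> - 2 e_i matches the exponents with
    \<open>\<alpha> i \<ge> 2\<close> to those of degree \<open>d - 2\<close>, and for
    \<open>\<alpha> i < 2\<close> the factor \<open>\<alpha> i * (\<alpha> i - 1)\<close> is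
    zero.\<close>
  have shift: "(\<Sum>\<alpha>\<in>exps n d. c \<alpha> * (real (\<alpha> i * (\<alpha> i - 1)) * N (\<alpha>(i := \<alpha> i - 2))))
     = (\<Sum>\<beta>\<in>exps n (d - 2). N \<beta> * (real ((\<beta> i + 2) * (\<beta> i + 1)) * c (\<beta>(i := \<beta> i + 2))))"
    (is "?L = ?R") if i: "i < n" for i
  proof -
    have "?L = (\<Sum>\<alpha>\<in>{\<alpha>\<in>exps n d. 2 \<le> \<alpha> i}.
        c \<alpha> * (real (\<alpha> i * (\<alpha> i - 1)) * N (\<alpha>(i := \<alpha> i - 2))))"
    proof (rule sum.mono_neutral_right)
      show "\<forall>\<alpha>\<in>exps n d - {\<alpha> \<in> exps n d. 2 \<le> \<alpha> i}.
          c \<alpha> * (real (\<alpha> i * (\<alpha> i - 1)) * N (\<alpha>(i := \<alpha> i - 2))) = 0"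
      proof
        fix \<alpha> assume "\<alpha> \<in> exps n d - {\<alpha> \<in> exps n d. 2 \<le> \<alpha> i}"
        then have "\<alpha> i = 0 \<or> \<alpha> i = 1" by auto
        then show "c \<alpha> * (real (\<alpha> i * (\<alpha> i - 1)) * N (\<alpha>(i := \<alpha> i - 2))) = 0" by auto
      qed
    qed (auto simp: finite_exps)
    also have "\<dots> = ?R"
    proof (rule sum.reindex_bij_witness[where i = "\<lambda>\<beta>. \<beta>(i := \<beta> i + 2)"
          and j = "\<lambda>\<alpha>. \<alpha>(i := \<alpha> i - 2)"])
      fix \<alpha> assume a: "\<alpha> \<in> {\<alpha> \<in> exps n d. 2 \<le> \<alpha> i}"
      show "\<alpha>(i := \<alpha> i - 2) \<in> exps n (d - 2)"
        using a i sum_fun_upd_nat[OF i, of \<alpha> "\<alpha> i - 2"] by (auto simp: exps_def)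
      have "\<alpha> i - 2 + 1 = \<alpha> i - 1" "\<alpha> i - 2 + 2 = \<alpha> i" using a by auto
      then show "N (\<alpha>(i := \<alpha> i - 2)) * (real (((\<alpha>(i := \<alpha> i - 2)) i + 2) * ((\<alpha>(i := \<alpha> i - 2)) i + 1)) *
          c ((\<alpha>(i := \<alpha> i - 2))(i := (\<alpha>(i := \<alpha> i - 2)) i + 2))) =
        c \<alpha> * (real (\<alpha> i * (\<alpha> i - 1)) * N (\<alpha>(i := \<alpha> i - 2)))"
        by (simp only: fun_upd_same fun_upd_upd fun_upd_triv mult_ac)
    next
      fix \<beta> assume b: "\<beta> \<in> exps n (d - 2)"
      show "\<beta>(i := \<beta> i + 2) \<in> {\<alpha> \<in> exps n d. 2 \<le> \<alpha> i}"
        using b i d sum_fun_upd_nat[OF i, of \<beta> "\<beta> i + 2"] by (auto simp: exps_def)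
    qed (auto simp: fun_eq_iff)
    finally show ?thesis .
  qed
  have "(\<Sum>x\<in>X. hpoly_eval n d c x) = (\<Sum>\<alpha>\<in>exps n d. c \<alpha> * moment X n \<alpha>)"
    unfolding hpoly_eval_def moment_def sum_distrib_left by (rule sum.swap)
  also have "\<dots> = (\<Sum>\<alpha>\<in>exps n d. \<Sum>i<n.
      c \<alpha> * (real (\<alpha> i * (\<alpha> i - 1)) * N (\<alpha>(i := \<alpha> i - 2))))"
    by (rule sum.cong) (simp_all only: eq sum_distrib_left)
  also have "\<dots> = (\<Sum>i<n. \<Sum>\<alpha>\<in>exps n d.
      c \<alpha> * (real (\<alpha> i * (\<alpha> i - 1)) * N (\<alpha>(i := \<alpha> i - 2))))"
    by (rule sum.swap)
  also have "\<dots> = (\<Sum>i<n. \<Sum>\<beta>\<in>exps n (d - 2).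
      N \<beta> * (real ((\<beta> i + 2) * (\<beta> i + 1)) * c (\<beta>(i := \<beta> i + 2))))"
    by (intro sum.cong refl shift) simp
  also have "\<dots> = (\<Sum>\<beta>\<in>exps n (d - 2). \<Sum>i<n.
      N \<beta> * (real ((\<beta> i + 2) * (\<beta> i + 1)) * c (\<beta>(i := \<beta> i + 2))))"
    by (rule sum.swap)
  also have "\<dots> = (\<Sum>\<beta>\<in>exps n (d - 2). N \<beta> *
      (\<Sum>i<n. real ((\<beta> i + 2) * (\<beta> i + 1)) * c (\<beta>(i := \<beta> i + 2))))"
    by (simp only: sum_distrib_left)
  also have "\<dots> = 0"
    using H by (intro sum.neutral) (auto simp: harmonic_hpoly_def simp del: of_nat_mult)
  finally show "(\<Sum>x\<in>X. hpoly_eval n d c x) = 0" .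
qed

section \<open>Sets invariant under permutations and sign changes\<close>

text \<open>Invariance under the Weyl group of type D_n. Signs change in pairs because a single sign
  change on a half-odd vector alters the parity of the coordinate sum.\<close>

definition D_invariant :: "nat \<Rightarrow> (nat \<Rightarrow> real) set \<Rightarrow> bool" where
  "D_invariant n X \<longleftrightarrow>
     (\<forall>p x. p permutes {..<n} \<longrightarrow> x \<in> X \<longrightarrow> x \<circ> p \<in> X) \<and>
     (\<forall>i<n. \<forall>j<n. \<forall>x\<in>X. i \<noteq> j \<longrightarrow> x(i := - x i, j := - x j) \<in> X)"

lemma D_invariant_sum_permute:
  assumes "D_invariant n X" "p permutes {..<n}"
  shows "(\<Sum>x\<in>X. f (x \<circ> p)) = (\<Sum>x\<in>X. f x)"
proof (rule sum.reindex_bij_witness[where i = "\<lambda>x. x \<circ> inv p" and j = "\<lambda>x. x \<circ> p"])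
  have p: "inv p permutes {..<n}" using assms(2) by (rule permutes_inv)
  show "x \<circ> inv p \<in> X" if "x \<in> X" for x
    using assms(1) p that by (auto simp: D_invariant_def)
  show "x \<circ> p \<in> X" if "x \<in> X" for x
    using assms that by (auto simp: D_invariant_def)
qed (auto simp: comp_assoc permutes_inv_o[OF assms(2)])

lemma D_invariant_sum_flip:
  assumes "D_invariant n X" "i < n" "j < n" "i \<noteq> j"
  shows "(\<Sum>x\<in>X. f (x(i := - x i, j := - x j))) = (\<Sum>x\<in>X. f x)"
  by (rule sum.reindex_bij_witness[where i = "\<lambda>x. x(i := - x i, j := - x j)"
        and j = "\<lambda>x. x(i := - x i, j := - x j)"])
     (use assms in \<open>auto simp: D_invariant_def fun_eq_iff\<close>)

text \<open>A degree below \<open>n\<close> leaves some coordinate \<open>k\<close> with exponent 0.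
  Changing the signs of \<open>i\<close> and \<open>k\<close> together then negates the monomial, so
  its sum equals its own negative.\<close>

lemma moment_odd:
  assumes "D_invariant n X" "\<alpha> \<in> exps n d" "d < n" "i < n" "odd (\<alpha> i)"
  shows "moment X n \<alpha> = 0"
proof -
  obtain k where k: "k < n" "\<alpha> k = 0"
  proof (rule ccontr)
    assume "\<not> thesis"
    with that have "1 \<le> \<alpha> k" if "k < n" for k using \<open>k < n\<close> by (metis less_one not_le)
    then have "(\<Sum>k<n. 1) \<le> (\<Sum>k<n. \<alpha> k)" by (intro sum_mono) auto
    with assms show False by (simp add: exps_def)
  qed
  have ik: "i \<noteq> k" using k assms by auto
  have "(\<Prod>l<n. (x(i := - x i, k := - x k)) l ^ \<alpha> l) = - (\<Prod>l<n. x l ^ \<alpha> l)" for x :: "nat \<Rightarrow> real"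
  proof -
    have "(\<Prod>l\<in>{..<n} - {i}. (x(i := - x i, k := - x k)) l ^ \<alpha> l) = (\<Prod>l\<in>{..<n} - {i}. x l ^ \<alpha> l)"
      by (rule prod.cong) (use k in auto)
    then show ?thesis
      using assms ik by (simp add: prod.remove[of "{..<n}" i])
  qed
  then have "moment X n \<alpha> = - moment X n \<alpha>"
    using D_invariant_sum_flip[OF assms(1) assms(4) k(1) ik, of "\<lambda>x. \<Prod>l<n. x l ^ \<alpha> l"]
    by (simp add: moment_def sum_negf)
  then show ?thesis by simp
qed

text \<open>Only even exponents have to be checked: an exponent with an odd entry has moment 0, and
  restricting \<open>N\<close> to even exponents makes the other side vanish there too.\<close>

lemma cond_C_even:
  assumes X: "D_invariant n X" and d: "d < n"
    and eq: "\<And>\<alpha>. \<alpha> \<in> exps n d \<Longrightarrow> (\<And>i. even (\<alpha> i)) \<Longrightarrow>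
      moment X n \<alpha> = (\<Sum>i<n. real (\<alpha> i * (\<alpha> i - 1)) * N (\<alpha>(i := \<alpha> i - 2)))"
  shows "cond_C n d X"
proof (rule cond_C_transpose_laplacian[where N = "\<lambda>\<beta>. if \<forall>i. even (\<beta> i) then N \<beta> else 0"])
  fix \<alpha> assume a: "\<alpha> \<in> exps n d"
  show "moment X n \<alpha> = (\<Sum>i<n. real (\<alpha> i * (\<alpha> i - 1)) *
      (if \<forall>j. even ((\<alpha>(i := \<alpha> i - 2)) j) then N (\<alpha>(i := \<alpha> i - 2)) else 0))"
  proof (cases "\<forall>i. even (\<alpha> i)")
    case True
    then show ?thesis by (subst eq[OF a]) (auto intro!: sum.cong)
  next
    case False
    then obtain i where i: "odd (\<alpha> i)" by auto
    then have "i < n" using a by (auto simp: exps_def) (metis not_le odd_pos less_irrefl)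
    \<comment> \<open>Subtracting 2 preserves parity except where it is truncated, at
      \<open>\<alpha> l = 1\<close>; there the factor in front is zero.\<close>
    have z: "real (\<alpha> l * (\<alpha> l - 1)) *
      (if \<forall>j. even ((\<alpha>(l := \<alpha> l - 2)) j) then N (\<alpha>(l := \<alpha> l - 2)) else 0) = 0" for l
    proof (cases "\<alpha> l < 2")
      case True
      then have "\<alpha> l = 0 \<or> \<alpha> l = 1" by auto
      then show ?thesis by auto
    next
      case False
      then have "odd ((\<alpha>(l := \<alpha> l - 2)) i)" using i by auto
      then have "\<not> (\<forall>j. even ((\<alpha>(l := \<alpha> l - 2)) j))" by blast
      then show ?thesis by (simp only: if_False mult_zero_right)
    qed
    show ?thesis
      unfolding z using moment_odd[OF X a d \<open>i < n\<close> i] by simp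
  qed
qed

text \<open>Peels one square off an even monomial. Iterated down to degree 0, it lists all even
  exponents of degree 2, 4 and 6.\<close>

lemma even_exps_Suc:
  assumes "\<alpha> \<in> exps n (d + 2)" "\<And>i. even (\<alpha> i)"
  obtains i \<alpha>' where "i < n" "\<alpha>' \<in> exps n d" "\<And>i. even (\<alpha>' i)" "\<alpha> = \<alpha>'(i := \<alpha>' i + 2)"
proof -
  have "\<exists>i<n. \<alpha> i \<noteq> 0"
  proof (rule ccontr)
    assume "\<not> (\<exists>i<n. \<alpha> i \<noteq> 0)"
    then have "(\<Sum>i<n. \<alpha> i) = 0" by simp
    with assms(1) show False by (simp add: exps_def)
  qed
  then obtain i where i: "i < n" "\<alpha> i \<noteq> 0" by auto
  with assms(2)[of i] have i2: "2 \<le> \<alpha> i" by presburger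
  show thesis
  proof (rule that[OF i(1)])
    show "\<alpha>(i := \<alpha> i - 2) \<in> exps n d"
      using assms i i2 sum_fun_upd_nat[OF i(1), of \<alpha> "\<alpha> i - 2"] by (auto simp: exps_def)
    show "even ((\<alpha>(i := \<alpha> i - 2)) j)" for j using assms(2)[of j] i2 by auto
    show "\<alpha> = (\<alpha>(i := \<alpha> i - 2))(i := (\<alpha>(i := \<alpha> i - 2)) i + 2)" using i2 by (auto simp: fun_eq_iff)
  qed
qed

lemma exps_0: "\<alpha> \<in> exps n 0 \<Longrightarrow> \<alpha> = (\<lambda>_. 0)"
  unfolding exps_def fun_eq_iff
  by (metis (mono_tags, lifting) finite_lessThan lessThan_iff mem_Collect_eq not_le sum_eq_0_iff)

section \<open>Reduction of symmetric sums to the coordinates 0, 1, 2\<close>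

lemma permutes_three:
  assumes "distinct [i, j, k]" "i < n" "j < n" "k < n" "3 \<le> (n::nat)"
  obtains p where "p permutes {..<n}" "p 0 = i" "p 1 = j" "p 2 = k"
proof -
  \<comment> \<open>Each further transposition acts on values: it sends the current image of the
    next index to its target and fixes the targets reached before.\<close>
  define p0 where "p0 = transpose 0 i"
  define p1 where "p1 = transpose (p0 1) j \<circ> p0"
  define p2 where "p2 = transpose (p1 2) k \<circ> p1"
  have p0: "p0 permutes {..<n}" "p0 0 = i"
    using assms by (auto simp: p0_def intro!: permutes_swap_id)
  have inj0: "p0 1 \<noteq> p0 0" using permutes_inj[OF p0(1)] by (metis injD zero_neq_one)
  have p1: "p1 permutes {..<n}" "p1 0 = i" "p1 1 = j"
    using assms p0 inj0 permutes_in_image[OF p0(1), of 1]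
    by (auto simp: p1_def intro!: permutes_compose permutes_swap_id)
  have inj1: "p1 2 \<noteq> p1 0" "p1 2 \<noteq> p1 1"
    using permutes_inj[OF p1(1)] by (auto simp: inj_eq)
  have "p2 permutes {..<n}" "p2 0 = i" "p2 1 = j" "p2 2 = k"
    using assms p1 inj1 permutes_in_image[OF p1(1), of 2]
    by (auto simp: p2_def intro!: permutes_compose permutes_swap_id)
  then show thesis by (rule that)
qed

lemma D_invariant_sum_three:
  assumes "D_invariant n X" "distinct [i, j, k]" "i < n" "j < n" "k < n"
  shows "(\<Sum>x\<in>X. f (x i) (x j) (x k)) = (\<Sum>x\<in>X. f (x 0) (x 1) (x (2::nat)))"
proof -
  have "card {i, j, k} \<le> card {..<n}" using assms by (intro card_mono) auto
  then have "3 \<le> n" using assms(2) by simp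
  then obtain p where p: "p permutes {..<n}" "p 0 = i" "p 1 = j" "p 2 = k"
    using permutes_three assms(2-5) by blast
  show ?thesis
    using D_invariant_sum_permute[OF assms(1) p(1), of "\<lambda>x. f (x 0) (x 1) (x 2)"] p(2-4)
    by simp
qed

lemma D_invariant_sum_one:
  assumes "D_invariant n X" "i < n"
  shows "(\<Sum>x\<in>X. f (x i)) = (\<Sum>x\<in>X. f (x 0))"
proof -
  obtain p where "p permutes {..<n}" "p 0 = i"
    by (rule that[of "transpose 0 i"]) (use assms in \<open>auto intro!: permutes_swap_id\<close>)
  then show ?thesis
    using D_invariant_sum_permute[OF assms(1), of p "\<lambda>x. f (x 0)"] by simp
qed

lemma D_invariant_sum_two:
  assumes "D_invariant n X" "i < n" "j < n" "i \<noteq> j" "3 \<le> n"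
  shows "(\<Sum>x\<in>X. f (x i) (x j)) = (\<Sum>x\<in>X. f (x 0) (x (1::nat)))"
proof -
  obtain k where "k < n" "k \<noteq> i" "k \<noteq> j"
  proof -
    have "\<not> {..<n} \<subseteq> {i, j}"
    proof
      assume "{..<n} \<subseteq> {i, j}"
      then have "card {..<n} \<le> card {i, j}" by (intro card_mono) auto
      with assms show False by simp
    qed
    then show thesis using that by auto
  qed
  then show ?thesis
    using D_invariant_sum_three[OF assms(1), of i j k "\<lambda>a b c. f a b"] assms by simp
qed

text \<open>Three variables suffice because an even monomial of degree at most 6 involves at most
  three; which three is immaterial by permutation invariance.\<close>

definition power_sum :: "(nat \<Rightarrow> real) set \<Rightarrow> nat \<Rightarrow> nat \<Rightarrow> nat \<Rightarrow> real" where
  "power_sum X a b c = (\<Sum>x\<in>X. x 0 ^ a * x 1 ^ b * x 2 ^ c)"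

lemma prod_power_support:
  fixes x :: "nat \<Rightarrow> real"
  assumes "finite A" "A \<subseteq> {..<n}" "\<And>i. i \<notin> A \<Longrightarrow> \<alpha> i = 0"
  shows "(\<Prod>i<n. x i ^ \<alpha> i) = (\<Prod>i\<in>A. x i ^ \<alpha> i)"
  using assms by (intro prod.mono_neutral_right) auto

lemma laplace_sum_support:
  fixes N :: "(nat \<Rightarrow> nat) \<Rightarrow> real"
  assumes "finite A" "A \<subseteq> {..<n}" "\<And>i. i \<notin> A \<Longrightarrow> \<alpha> i = 0"
  shows "(\<Sum>i<n. real (\<alpha> i * (\<alpha> i - 1)) * N (\<alpha>(i := \<alpha> i - 2))) =
         (\<Sum>i\<in>A. real (\<alpha> i * (\<alpha> i - 1)) * N (\<alpha>(i := \<alpha> i - 2)))"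
  using assms by (intro sum.mono_neutral_right) auto

lemma moment_one:
  assumes "D_invariant n X" "i < n"
  shows "moment X n ((\<lambda>_. 0)(i := a)) = power_sum X a 0 0"
proof -
  have "moment X n ((\<lambda>_. 0)(i := a)) = (\<Sum>x\<in>X. x i ^ a)"
    unfolding moment_def by (subst prod_power_support[of "{i}"]) (use assms in auto)
  then show ?thesis
    using D_invariant_sum_one[OF assms, of "\<lambda>t. t ^ a"] by (simp add: power_sum_def)
qed

lemma moment_two:
  assumes "D_invariant n X" "i < n" "j < n" "i \<noteq> j" "3 \<le> n"
  shows "moment X n ((\<lambda>_. 0)(i := a, j := b)) = power_sum X a b 0"
proof -
  have "moment X n ((\<lambda>_. 0)(i := a, j := b)) = (\<Sum>x\<in>X. x i ^ a * x j ^ b)"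
    unfolding moment_def by (subst prod_power_support[of "{i, j}"]) (use assms in auto)
  then show ?thesis
    using D_invariant_sum_two[OF assms, of "\<lambda>s t. s ^ a * t ^ b"] by (simp add: power_sum_def)
qed

lemma moment_three:
  assumes "D_invariant n X" "distinct [i, j, k]" "i < n" "j < n" "k < n"
  shows "moment X n ((\<lambda>_. 0)(i := a, j := b, k := c)) = power_sum X a b c"
proof -
  have "moment X n ((\<lambda>_. 0)(i := a, j := b, k := c)) = (\<Sum>x\<in>X. x i ^ a * x j ^ b * x k ^ c)"
    unfolding moment_def
    by (subst prod_power_support[of "{i, j, k}"]) (use assms in \<open>auto simp: mult_ac\<close>)
  then show ?thesis
    using D_invariant_sum_three[OF assms, of "\<lambda>r s t. r ^ a * s ^ b * t ^ c"]
    by (simp add: power_sum_def)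
qed

section \<open>Criteria for the conditions of degree 2, 4 and 6 in terms of power sums\<close>

lemma cond_C_2:
  assumes "D_invariant n X" "3 \<le> n"
  shows "cond_C n 2 X"
\<comment> \<open>The exponent of x_i^2 contributes the factor 2 * 1, whence the division by
  2.\<close>
proof (rule cond_C_even[OF assms(1), where N = "\<lambda>_. power_sum X 2 0 0 / 2"])
  fix \<alpha> assume a: "\<alpha> \<in> exps n 2" "\<And>i. even (\<alpha> i)"
  obtain i \<alpha>' where "i < n" "\<alpha>' \<in> exps n 0" "\<alpha> = \<alpha>'(i := \<alpha>' i + 2)"
    using even_exps_Suc[of \<alpha> n 0] a by (metis add_0)
  then have i: "i < n" "\<alpha> = (\<lambda>_. 0)(i := 2)" by (auto dest!: exps_0)
  show "moment X n \<alpha> = (\<Sum>i<n. real (\<alpha> i * (\<alpha> i - 1)) * (power_sum X 2 0 0 / 2))"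
    unfolding i(2) moment_one[OF assms(1) i(1)]
    by (subst laplace_sum_support[of "{i}" n _ "\<lambda>_. power_sum X 2 0 0 / 2"]) (use i(1) in auto)
qed (use assms in auto)

text \<open>By symmetry \<open>N\<close> is sought as a constant v. The monomials x_i^4 and x_i^2
  x_j^2 require 12 v and 4 v as their moments; the second equation determines v, and the hypothesis
  \<open>S\<close> is the first.\<close>

lemma cond_C_4:
  assumes "D_invariant n X" "5 \<le> n" and S: "power_sum X 4 0 0 = 3 * power_sum X 2 2 0"
  shows "cond_C n 4 X"
proof (rule cond_C_even[OF assms(1), where N = "\<lambda>_. power_sum X 2 2 0 / 4"])
  have n: "3 \<le> n" using assms by simp
  fix \<alpha> assume a: "\<alpha> \<in> exps n 4" "\<And>i. even (\<alpha> i)"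
  obtain i \<alpha>' where i: "i < n" "\<alpha>' \<in> exps n 2" "\<And>l. even (\<alpha>' l)" "\<alpha> = \<alpha>'(i := \<alpha>' i + 2)"
    by (rule even_exps_Suc[of \<alpha> n 2]) (use a in auto)
  obtain j \<alpha>'' where j: "j < n" "\<alpha>'' \<in> exps n 0" "\<alpha>' = \<alpha>''(j := \<alpha>'' j + 2)"
    by (rule even_exps_Suc[of \<alpha>' n 0]) (use i in \<open>auto simp: numeral_2_eq_2\<close>)
  have j': "\<alpha>' = (\<lambda>_. 0)(j := 2)" using j by (auto dest!: exps_0)
  consider "i = j" "\<alpha> = (\<lambda>_. 0)(i := 4)" | "i \<noteq> j" "\<alpha> = (\<lambda>_. 0)(i := 2, j := 2)"
    using i(4) j' by (cases "i = j") (auto simp: fun_eq_iff)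
  then show "moment X n \<alpha> = (\<Sum>i<n. real (\<alpha> i * (\<alpha> i - 1)) * (power_sum X 2 2 0 / 4))"
  proof cases
    case 1
    show ?thesis
      unfolding 1(2) moment_one[OF assms(1) i(1)]
      by (subst laplace_sum_support[of "{i}" n _ "\<lambda>_. power_sum X 2 2 0 / 4"]) (use i(1) S in auto)
  next
    case 2
    show ?thesis
      unfolding 2(2) moment_two[OF assms(1) i(1) j(1) 2(1) n]
      by (subst laplace_sum_support[of "{i, j}" n _ "\<lambda>_. power_sum X 2 2 0 / 4"])
         (use i(1) j(1) 2(1) in auto)
  qed
qed (use assms in auto)

text \<open>By symmetry \<open>N\<close> takes a value u on x_i^4 and a value v on x_i^2 x_j^2. The
  moments of x_i^6, x_i^4 x_j^2 and x_i^2 x_j^2 x_k^2 must be 30 u, 2 u + 12 v and 6 v. The first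
  and last equations determine u and v; the middle one is then the hypothesis
  \<open>S\<close>.\<close>

lemma cond_C_6:
  assumes "D_invariant n X" "7 \<le> n"
    and S: "power_sum X 6 0 0 - 15 * power_sum X 4 2 0 + 30 * power_sum X 2 2 2 = 0"
  shows "cond_C n 6 X"
proof -
  define N where "N = (\<lambda>\<beta>::nat\<Rightarrow>nat. if \<exists>i. \<beta> i = 4 then power_sum X 6 0 0 / 30
    else power_sum X 2 2 2 / 6)"
  have N4: "N ((\<lambda>_. 0)(i := 4)) = power_sum X 6 0 0 / 30" for i
    by (auto simp: N_def)
  have N22: "N ((\<lambda>_. 0)(i := 2, j := 2)) = power_sum X 2 2 2 / 6" for i j
    by (auto simp: N_def)
  have n: "3 \<le> n" using assms by simp
  show ?thesis
  proof (rule cond_C_even[OF assms(1), where N = N])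
    fix \<alpha> assume a: "\<alpha> \<in> exps n 6" "\<And>i. even (\<alpha> i)"
    obtain i \<alpha>' where i: "i < n" "\<alpha>' \<in> exps n 4" "\<And>l. even (\<alpha>' l)" "\<alpha> = \<alpha>'(i := \<alpha>' i + 2)"
      by (rule even_exps_Suc[of \<alpha> n 4]) (use a in auto)
    obtain j \<alpha>2 where j: "j < n" "\<alpha>2 \<in> exps n 2" "\<And>l. even (\<alpha>2 l)" "\<alpha>' = \<alpha>2(j := \<alpha>2 j + 2)"
      by (rule even_exps_Suc[of \<alpha>' n 2]) (use i in auto)
    obtain k \<alpha>3 where k: "k < n" "\<alpha>3 \<in> exps n 0" "\<alpha>2 = \<alpha>3(k := \<alpha>3 k + 2)"
      by (rule even_exps_Suc[of \<alpha>2 n 0]) (use j in \<open>auto simp: numeral_2_eq_2\<close>)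
    have k': "\<alpha>2 = (\<lambda>_. 0)(k := 2)" using k by (auto dest!: exps_0)
    \<comment> \<open>The cases are the partitions 6, 4 + 2 and 2 + 2 + 2. The combinations of
      equalities not listed below contradict transitivity.\<close>
    have "(\<exists>i<n. \<alpha> = (\<lambda>_. 0)(i := 6)) \<or> (\<exists>i<n. \<exists>j<n. i \<noteq> j \<and> \<alpha> = (\<lambda>_. 0)(i := 4, j := 2))
        \<or> (distinct [i, j, k] \<and> \<alpha> = (\<lambda>_. 0)(i := 2, j := 2, k := 2))"
    proof (cases "i = j"; cases "j = k"; cases "i = k")
      assume "i = j" "j = k" "i = k"
      then have "\<alpha> = (\<lambda>_. 0)(i := 6)" using i(4) j(4) k' by auto
      then show ?thesis using i(1) by blast
    next
      assume "i = j" "j \<noteq> k" "i \<noteq> k"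
      then have "\<alpha> = (\<lambda>_. 0)(i := 4, k := 2)" using i(4) j(4) k' by (auto simp: fun_eq_iff)
      then show ?thesis using i(1) k(1) \<open>i \<noteq> k\<close> by blast
    next
      assume "i \<noteq> j" "j = k" "i \<noteq> k"
      then have "\<alpha> = (\<lambda>_. 0)(j := 4, i := 2)" using i(4) j(4) k' by (auto simp: fun_eq_iff)
      then show ?thesis using i(1) j(1) \<open>i \<noteq> j\<close> by blast
    next
      assume "i \<noteq> j" "j \<noteq> k" "i = k"
      then have "\<alpha> = (\<lambda>_. 0)(i := 4, j := 2)" using i(4) j(4) k' by (auto simp: fun_eq_iff)
      then show ?thesis using i(1) j(1) \<open>i \<noteq> j\<close> by blast
    next
      assume "i \<noteq> j" "j \<noteq> k" "i \<noteq> k"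
      then have "\<alpha> = (\<lambda>_. 0)(i := 2, j := 2, k := 2)" using i(4) j(4) k' by (auto simp: fun_eq_iff)
      then show ?thesis using \<open>i \<noteq> j\<close> \<open>j \<noteq> k\<close> \<open>i \<noteq> k\<close> by auto
    qed auto
    then show "moment X n \<alpha> = (\<Sum>i<n. real (\<alpha> i * (\<alpha> i - 1)) * N (\<alpha>(i := \<alpha> i - 2)))"
    proof (elim disjE exE conjE)
      fix i assume i: "i < n" and al: "\<alpha> = (\<lambda>_. 0)(i := 6)"
      show ?thesis
        unfolding al moment_one[OF assms(1) i]
        by (subst laplace_sum_support[of "{i}"]) (use i in \<open>auto simp: N4\<close>)
    next
      fix i j assume ij: "i < n" "j < n" "i \<noteq> j" and al: "\<alpha> = (\<lambda>_. 0)(i := 4, j := 2)"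
      have 1: "((\<lambda>_. 0)(i := 4, j := 2))(i := 2) = ((\<lambda>_. 0)(i := 2, j := 2) :: nat \<Rightarrow> nat)"
        using ij by (auto simp: fun_eq_iff)
      have 2: "((\<lambda>_. 0)(i := 4, j := 0)) = ((\<lambda>_. 0)(i := 4) :: nat \<Rightarrow> nat)"
        using ij by (auto simp: fun_eq_iff)
      show ?thesis
        unfolding al moment_two[OF assms(1) ij n]
        by (subst laplace_sum_support[of "{i, j}"]) (use ij S in \<open>auto simp: 1 2 N4 N22\<close>)
    next
      assume d: "distinct [i, j, k]" and al: "\<alpha> = (\<lambda>_. 0)(i := 2, j := 2, k := 2)"
      have 1: "((\<lambda>_. 0)(i := 2, j := 2, k := 2))(i := 0) = ((\<lambda>_. 0)(j := 2, k := 2) :: nat \<Rightarrow> nat)"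
        "((\<lambda>_. 0)(i := 2, j := 2, k := 2))(j := 0) = ((\<lambda>_. 0)(i := 2, k := 2) :: nat \<Rightarrow> nat)"
        "((\<lambda>_. 0)(i := 2, j := 2, k := 0)) = ((\<lambda>_. 0)(i := 2, j := 2) :: nat \<Rightarrow> nat)"
        using d by (auto simp: fun_eq_iff)
      show ?thesis
        unfolding al moment_three[OF assms(1) d i(1) j(1) k(1)]
        by (subst laplace_sum_support[of "{i, j, k}"]) (use d i(1) j(1) k(1) in \<open>auto simp: 1 N22\<close>)
    qed
  qed (use assms in auto)
qed

section \<open>The lattices\<close>

text \<open>The values 0 and 1 of \<open>e\<close> cover the lattice and, for n congruent to 4
  modulo 8, its shadow, so that invariance is proved once for both.\<close>

definition W_coset :: "nat \<Rightarrow> real \<Rightarrow> (nat \<Rightarrow> real) set" where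
  "W_coset n e = {x \<in> vecs n. (\<forall>i<n. 2 * x i \<in> \<int> \<and> x i - x 0 \<in> \<int>)
                        \<and> (\<exists>k::int. (\<Sum>i<n. x i) = 2 * of_int k + e)}"

lemma W_eq_W_coset: "W n = W_coset n 0"
  by (auto simp: W_def W_coset_def)

lemma ShW_eq_W_coset: "ShW n = W_coset n (if n mod 8 = 0 then 0 else 1)"
  by (auto simp: W_eq_W_coset ShW_def W_coset_def)

text \<open>A coordinate k/2 of such a vector has k^2 \<le> 4 m, so |k| \<le> k^2 leaves finitely
  many values. This finiteness is what later allows sums over shells to be split into
  pieces.\<close>

lemma finite_half_integral_sphere:
  "finite {x \<in> vecs n. (\<forall>i<n. 2 * x i \<in> \<int>) \<and> inner_n n x x = m}"
proof (rule finite_subset)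
  define B where "B = (\<lambda>k::int. of_int k / 2 :: real) ` {- \<lceil>4 * m\<rceil>..\<lceil>4 * m\<rceil>}"
  show "{x \<in> vecs n. (\<forall>i<n. 2 * x i \<in> \<int>) \<and> inner_n n x x = m} \<subseteq>
      {x. \<forall>i. (i \<in> {..<n} \<longrightarrow> x i \<in> B) \<and> (i \<notin> {..<n} \<longrightarrow> x i = 0)}"
  proof (intro subsetI CollectI allI conjI impI)
    fix x i assume x: "x \<in> {x \<in> vecs n. (\<forall>i<n. 2 * x i \<in> \<int>) \<and> inner_n n x x = m}" and i: "i \<in> {..<n}"
    then obtain k where k: "2 * x i = of_int k" by (auto elim: Ints_cases)
    have "x i * x i \<le> m"
      using x i member_le_sum[of i "{..<n}" "\<lambda>i. x i * x i"] by (auto simp: inner_n_def)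
    then have "(2 * x i) * (2 * x i) \<le> 4 * m" by simp
    then have "of_int (k * k) \<le> 4 * m" unfolding k by simp
    then have "k * k \<le> \<lceil>4 * m\<rceil>" by linarith
    moreover have "\<bar>k\<bar> \<le> k * k"
    proof (cases "k = 0")
      case False
      then have "\<bar>k\<bar> * 1 \<le> \<bar>k\<bar> * \<bar>k\<bar>" by (intro mult_left_mono) auto
      then show ?thesis by simp
    qed simp
    ultimately have "k \<in> {- \<lceil>4 * m\<rceil>..\<lceil>4 * m\<rceil>}" by auto
    moreover have "x i = of_int k / 2" using k by simp
    ultimately show "x i \<in> B" unfolding B_def by blast
  qed (auto simp: vecs_def)
  show "finite {x. \<forall>i. (i \<in> {..<n} \<longrightarrow> x i \<in> B) \<and> (i \<notin> {..<n} \<longrightarrow> x i = 0)}"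
    by (rule finite_set_of_finite_funs) (auto simp: B_def)
qed

text \<open>The point is the sign change: it alters the coordinate sum by twice x_i + x_j, which is
  an integer since all coordinates are congruent modulo 1 and \<open>2 * x j\<close> is an
  integer.\<close>

lemma D_invariant_shell: "D_invariant n (shell n (W_coset n e) m)"
  unfolding D_invariant_def
proof (intro conjI allI impI ballI)
  fix p x assume p: "p permutes {..<n}" and x: "x \<in> shell n (W_coset n e) m"
  have pn: "p i < n" if "i < n" for i using permutes_in_image[OF p] that by auto
  have "x (p i) - x (p 0) \<in> \<int>" if "i < n" for i
  proof -
    have "x (p i) - x (p 0) = (x (p i) - x 0) - (x (p 0) - x 0)" by simp
    also have "\<dots> \<in> \<int>"
      by (rule Ints_diff) (use x pn that pn[of 0] in \<open>auto simp: shell_def W_coset_def\<close>)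
    finally show ?thesis .
  qed
  moreover have "x (p i) = 0" if "n \<le> i" for i
    using x that permutes_not_in[OF p, of i] by (auto simp: shell_def W_coset_def vecs_def)
  moreover have "(\<Sum>i<n. f (p i)) = (\<Sum>i<n. f i)" for f :: "nat \<Rightarrow> real"
    using sum.permute[OF p, of f] by simp
  ultimately show "x \<circ> p \<in> shell n (W_coset n e) m"
    using x pn by (auto simp: shell_def W_coset_def vecs_def inner_n_def)
next
  fix i j x assume ij: "i < n" "j < n" "i \<noteq> j" and x: "x \<in> shell n (W_coset n e) m"
  let ?y = "x(i := - x i, j := - x j)"
  have split: "(\<Sum>l<n. f l) = f i + f j + (\<Sum>l\<in>{..<n} - {i, j}. f l)" for f :: "nat \<Rightarrow> real"
    using ij sum.subset_diff[of "{i, j}" "{..<n}" f] by simp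
  have rest: "(\<Sum>l\<in>{..<n} - {i, j}. f (?y l)) = (\<Sum>l\<in>{..<n} - {i, j}. f (x l))" for f :: "real \<Rightarrow> real"
    by (rule sum.cong) auto
  have xi: "2 * x l \<in> \<int>" "x l - x 0 \<in> \<int>" if "l < n" for l
    using x that by (auto simp: shell_def W_coset_def)
  have a: "- x l - x 0 \<in> \<int>" "x l + x 0 \<in> \<int>" if "l < n" for l
  proof -
    have "x l + x 0 = 2 * x l - (x l - x 0)" by simp
    then show "x l + x 0 \<in> \<int>" using xi that by (metis Ints_diff)
    then have "- (x l + x 0) \<in> \<int>" by (rule Ints_minus)
    then show "- x l - x 0 \<in> \<int>" by simp
  qed
  have b: "- x l + x 0 \<in> \<int>" if "l < n" for l
    using Ints_minus[OF xi(2)[OF that]] by simp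
  have "(\<Sum>l<n. ?y l * ?y l) = (\<Sum>l<n. x l * x l)"
    unfolding split using ij rest[of "\<lambda>t. t * t"] by simp
  moreover have "\<exists>k::int. (\<Sum>l<n. ?y l) = 2 * of_int k + e"
  proof -
    obtain k where k: "(\<Sum>l<n. x l) = 2 * of_int k + e"
      using x by (auto simp: shell_def W_coset_def)
    have "x i + x j = (x i - x 0) - (x j - x 0) + 2 * x j" by simp
    also have "\<dots> \<in> \<int>" by (rule Ints_add, rule Ints_diff) (use xi ij in auto)
    finally obtain l where l: "x i + x j = of_int l" by (auto elim: Ints_cases)
    have "(\<Sum>l<n. ?y l) = (\<Sum>l<n. x l) - 2 * (x i + x j)"
      unfolding split using ij rest[of "\<lambda>t. t"] by simp
    also have "\<dots> = 2 * of_int (k - l) + e" unfolding k l by simp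
    finally show ?thesis by blast
  qed
  moreover have "2 * ?y l \<in> \<int>" if "l < n" for l
    using xi(1)[OF that] Ints_minus[OF xi(1)[OF that]] by auto
  moreover have "?y l - ?y 0 \<in> \<int>" if "l < n" for l
    using xi[OF that] a[OF that] b[OF that] by (auto simp: algebra_simps)
  moreover have "?y \<in> vecs n" using x ij by (auto simp: shell_def W_coset_def vecs_def)
  ultimately show "?y \<in> shell n (W_coset n e) m"
    using x by (simp add: shell_def W_coset_def inner_n_def)
qed

section \<open>Blocks of four coordinates and cosets of the root lattice of type D4\<close>

definition blk :: "nat \<Rightarrow> (nat \<Rightarrow> real) \<Rightarrow> nat \<Rightarrow> real" where
  "blk b x = (\<lambda>i. if i < 4 then x (4 * b + i) else 0)"

definition on_blk :: "nat \<Rightarrow> ((nat \<Rightarrow> real) \<Rightarrow> nat \<Rightarrow> real) \<Rightarrow> (nat \<Rightarrow> real) \<Rightarrow> nat \<Rightarrow> real" where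
  "on_blk b g x = (\<lambda>i. if i div 4 = b then g (blk b x) (i mod 4) else x i)"

text \<open>The four cosets of the root lattice in its dual: the first flag says whether the entries are
  half-odd, the second one is the parity of their sum.\<close>

definition D4_coset :: "bool \<times> bool \<Rightarrow> (nat \<Rightarrow> real) set" where
  "D4_coset a = {u \<in> vecs 4. (\<forall>i<4. u i - of_bool (fst a) / 2 \<in> \<int>) \<and>
     (\<exists>k::int. (\<Sum>i<4. u i) = 2 * of_int k + of_bool (snd a))}"

text \<open>The orthogonal reflection that negates (1/2,1/2,1/2,1/2), a vector of norm 1.\<close>

definition D4_refl :: "(nat \<Rightarrow> real) \<Rightarrow> nat \<Rightarrow> real" where
  "D4_refl u = (\<lambda>i. if i < 4 then u i - (\<Sum>j<4. u j) / 2 else 0)"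

definition D4_flip :: "(nat \<Rightarrow> real) \<Rightarrow> nat \<Rightarrow> real" where
  "D4_flip u = u(0 := - u 0)"

lemma sum4: "(\<Sum>i<4::nat. f i) = f 0 + f 1 + f 2 + (f 3 :: 'a :: comm_monoid_add)"
  by (simp add: eval_nat_numeral add_ac)

lemma blk_vecs [simp]: "blk b x \<in> vecs 4"
  by (simp add: blk_def vecs_def)

lemma blk_on_blk:
  assumes "\<And>u. u \<in> vecs 4 \<Longrightarrow> g u \<in> vecs 4"
  shows "blk c (on_blk b g x) = (if c = b then g (blk b x) else blk c x)"
  using assms[of "blk b x"] by (auto simp: blk_def on_blk_def fun_eq_iff vecs_def)

lemma vecs_blk_eqI:
  assumes "x \<in> vecs (4 * N)" "y \<in> vecs (4 * N)" "\<And>b. b < N \<Longrightarrow> blk b x = blk b y"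
  shows "x = y"
proof
  fix i
  show "x i = y i"
  proof (cases "i < 4 * N")
    case True
    then have "blk (i div 4) x (i mod 4) = blk (i div 4) y (i mod 4)"
      using assms(3)[of "i div 4"] by auto
    then show ?thesis by (simp add: blk_def)
  next
    case False
    then show ?thesis using assms by (simp add: vecs_def)
  qed
qed

lemma on_blk_vecs: "b < N \<Longrightarrow> x \<in> vecs (4 * N) \<Longrightarrow> on_blk b g x \<in> vecs (4 * N)"
  by (auto simp: on_blk_def vecs_def)

lemma sum_blk: "(\<Sum>i<4 * N. x i) = (\<Sum>b<N. \<Sum>i<4. blk b x i)"
proof (induction N)
  case (Suc N)
  have e: "4 * Suc N = Suc (Suc (Suc (Suc (4 * N))))" by simp
  have "(\<Sum>i<4 * Suc N. x i) = (\<Sum>i<4 * N. x i) + (\<Sum>i<4. blk N x i)"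
    unfolding e by (simp add: sum4 blk_def add_ac numeral_3_eq_3)
  then show ?case using Suc by simp
qed simp

lemma inner_blk: "inner_n (4 * N) x x = (\<Sum>b<N. inner_n 4 (blk b x) (blk b x))"
  using sum_blk[of "\<lambda>i. x i * x i" N] by (simp add: inner_n_def blk_def sum4)

text \<open>The first flag is read off one coordinate modulo 1, the second off the coordinate sum
  modulo 2.\<close>

lemma D4_coset_unique:
  assumes "u \<in> D4_coset a" "u \<in> D4_coset b"
  shows "a = b"
proof -
  obtain h p h' p' where ab: "a = (h, p)" "b = (h', p')" by (metis surj_pair)
  have "(u 0 - of_bool h' / 2) - (u 0 - of_bool h / 2) \<in> \<int>"
    by (rule Ints_diff) (use assms in \<open>auto simp: D4_coset_def ab\<close>)
  then obtain k :: int where "of_bool h / 2 - of_bool h' / 2 = (of_int k :: real)"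
    by (auto elim: Ints_cases)
  then have "of_int (of_bool h) = (of_int (2 * k + of_bool h') :: real)" by (simp add: field_simps)
  then have "of_bool h = 2 * k + of_bool h'" by (simp only: of_int_eq_iff)
  then have h: "h = h'" by (cases h; cases h') (simp_all, presburger+)
  obtain k l :: int where "2 * of_int k + of_bool p = (2 * of_int l + of_bool p' :: real)"
    using assms by (auto simp: D4_coset_def ab)
  then have "of_int (2 * k + of_bool p) = (of_int (2 * l + of_bool p') :: real)" by simp
  then have "2 * k + of_bool p = 2 * l + of_bool p'" by (simp only: of_int_eq_iff)
  then have p: "p = p'" by (cases p; cases p') (simp_all, presburger+)
  show ?thesis using h p ab by simp
qed

lemma D4_coset_half_integral: "u \<in> D4_coset a \<Longrightarrow> i < 4 \<Longrightarrow> 2 * u i \<in> \<int>"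
proof -
  assume "u \<in> D4_coset a" "i < 4"
  then have "(u i - of_bool (fst a) / 2) + (u i - of_bool (fst a) / 2) + of_bool (fst a) \<in> \<int>"
    by (intro Ints_add) (auto simp: D4_coset_def)
  then show ?thesis by simp
qed

lemma D4_refl_vecs: "D4_refl u \<in> vecs 4"
  by (simp add: D4_refl_def vecs_def)

lemma D4_flip_vecs: "u \<in> vecs 4 \<Longrightarrow> D4_flip u \<in> vecs 4"
  by (simp add: D4_flip_def vecs_def)

lemma D4_refl_refl: "u \<in> vecs 4 \<Longrightarrow> D4_refl (D4_refl u) = u"
  by (auto simp: D4_refl_def vecs_def fun_eq_iff sum4 field_simps)

lemma D4_flip_flip: "D4_flip (D4_flip u) = u"
  by (auto simp: D4_flip_def)

lemma inner_D4_refl: "inner_n 4 (D4_refl u) (D4_refl u) = inner_n 4 u u"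
  by (simp add: inner_n_def D4_refl_def sum4) (simp add: field_simps)

lemma inner_D4_flip: "inner_n 4 (D4_flip u) (D4_flip u) = inner_n 4 u u"
  by (simp add: inner_n_def D4_flip_def sum4)

text \<open>If the coordinates sum to 2 k + p, the reflection subtracts k + p/2 from each of them,
  which toggles half-oddness exactly when p is odd; the sum itself is negated and keeps its parity.
  So the cosets \<open>(False, True)\<close> and \<open>(True, True)\<close> are exchanged and the
  other two are fixed.\<close>

lemma D4_refl_coset:
  assumes "u \<in> D4_coset (h, p)"
  shows "D4_refl u \<in> D4_coset (h \<noteq> p, p)"
proof -
  obtain k :: int where k: "(\<Sum>i<4. u i) = 2 * of_int k + of_bool p"
    using assms by (auto simp: D4_coset_def)
  have "D4_refl u i - of_bool (h \<noteq> p) / 2 \<in> \<int>" if "i < 4" for i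
  proof -
    have "D4_refl u i - of_bool (h \<noteq> p) / 2 =
        (u i - of_bool h / 2) - of_int k - of_int (of_bool (\<not> h \<and> p))"
      using that k by (auto simp: D4_refl_def field_simps)
    also have "\<dots> \<in> \<int>" by (rule Ints_diff, rule Ints_diff) (use assms that in \<open>auto simp: D4_coset_def\<close>)
    finally show ?thesis .
  qed
  moreover have "(\<Sum>i<4. D4_refl u i) = 2 * of_int (- k - of_bool p) + of_bool p"
  proof -
    have "(\<Sum>i<4. D4_refl u i) = - (\<Sum>i<4. u i)" by (simp add: D4_refl_def sum4)
    then show ?thesis using k by simp
  qed
  ultimately show ?thesis using D4_refl_vecs unfolding D4_coset_def fst_conv snd_conv by blast
qed

text \<open>The sum changes by \<open>2 * u 0\<close>, which is odd exactly for half-odd vectors. So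
  \<open>(True, False)\<close> and \<open>(True, True)\<close> are exchanged and the integral cosets
  are fixed.\<close>

lemma D4_flip_coset:
  assumes "u \<in> D4_coset (h, p)"
  shows "D4_flip u \<in> D4_coset (h, p \<noteq> h)"
proof -
  obtain k :: int where k: "(\<Sum>i<4. u i) = 2 * of_int k + of_bool p"
    using assms by (auto simp: D4_coset_def)
  have "u 0 - of_bool h / 2 \<in> \<int>" using assms by (auto simp: D4_coset_def)
  then obtain l :: int where "u 0 - of_bool h / 2 = of_int l" by (auto elim: Ints_cases)
  then have l: "u 0 = of_int l + of_bool h / 2" by simp
  have "D4_flip u i - of_bool h / 2 \<in> \<int>" if "i < 4" for i
  proof (cases "i = 0")
    case True
    then have "D4_flip u i - of_bool h / 2 = of_int (- l - of_bool h)"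
      using l by (simp add: D4_flip_def)
    then show ?thesis by (metis Ints_of_int)
  next
    case False
    then show ?thesis using assms that by (auto simp: D4_flip_def D4_coset_def)
  qed
  moreover have "(\<Sum>i<4. D4_flip u i) = 2 * of_int (k - l - of_bool (h \<and> \<not> p)) + of_bool (p \<noteq> h)"
  proof -
    have "(\<Sum>i<4. D4_flip u i) = (\<Sum>i<4. u i) - 2 * u 0" by (simp add: D4_flip_def sum4)
    then show ?thesis using k l by (cases h; cases p) auto
  qed
  ultimately show ?thesis
    using D4_flip_vecs assms unfolding D4_coset_def fst_conv snd_conv by blast
qed

section \<open>The lattices as unions of cosets of sums of copies of D4\<close>

lemma D4_coset_exists:
  assumes "u \<in> vecs 4" "\<And>i. i < 4 \<Longrightarrow> u i - of_bool h / 2 \<in> \<int>"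
  shows "\<exists>p. u \<in> D4_coset (h, p)"
proof -
  have "(u 0 - of_bool h / 2) + (u 1 - of_bool h / 2) + (u 2 - of_bool h / 2) + (u 3 - of_bool h / 2)
     + 2 * of_bool h \<in> \<int>"
    by (intro Ints_add Ints_mult assms) auto
  then have "(\<Sum>i<4. u i) \<in> \<int>" by (simp add: sum4 algebra_simps)
  then obtain k where k: "(\<Sum>i<4. u i) = of_int k" by (auto elim: Ints_cases)
  have "k = 2 * (k div 2) + of_bool (odd k)" by (cases "even k") auto
  then have "(\<Sum>i<4. u i) = 2 * of_int (k div 2) + of_bool (odd k)"
    using k by (metis of_int_add of_int_mult of_int_numeral of_int_of_bool)
  then show ?thesis using assms unfolding D4_coset_def by auto
qed

text \<open>All coordinates are congruent modulo 1, so a single flag \<open>h\<close> serves every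
  block; the total sum is even exactly when an even number of blocks have odd sum.\<close>

lemma W_blk_iff:
  assumes "0 < N"
  shows "x \<in> W (4 * N) \<longleftrightarrow> x \<in> vecs (4 * N) \<and>
    (\<exists>h p. (\<forall>b<N. blk b x \<in> D4_coset (h, p b)) \<and> even (\<Sum>b<N. of_bool (p b) :: int))"
proof
  assume x: "x \<in> W (4 * N)"
  then have xi: "2 * x i \<in> \<int>" "x i - x 0 \<in> \<int>" if "i < 4 * N" for i
    using that by (auto simp: W_def)
  define h where "h = (x 0 \<notin> \<int>)"
  have h0: "x 0 - of_bool h / 2 \<in> \<int>"
  proof (cases h)
    case True
    obtain k where k: "2 * x 0 = of_int k" using xi(1)[of 0] assms by (auto elim: Ints_cases)
    have "odd k"
    proof
      assume "even k"
      then obtain l where "k = 2 * l" by (rule evenE)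
      then have "x 0 = of_int l" using k by simp
      then show False using True h_def by simp
    qed
    then obtain l where "k = 2 * l + 1" by (rule oddE)
    then have "x 0 - of_bool h / 2 = of_int l" using k True by simp
    then show ?thesis by simp
  qed (simp add: h_def)
  have hi: "x i - of_bool h / 2 \<in> \<int>" if "i < 4 * N" for i
    using Ints_add[OF xi(2)[OF that] h0] by simp
  have "\<exists>p. blk b x \<in> D4_coset (h, p)" if "b < N" for b
    by (rule D4_coset_exists[OF blk_vecs]) (use hi that in \<open>auto simp: blk_def\<close>)
  then obtain p where p: "blk b x \<in> D4_coset (h, p b)" if "b < N" for b by metis
  then have "\<exists>k::int. (\<Sum>i<4. blk b x i) = 2 * of_int k + of_bool (p b)" if "b < N" for b
    using that by (auto simp: D4_coset_def)
  then obtain k :: "nat \<Rightarrow> int"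
    where k: "(\<Sum>i<4. blk b x i) = 2 * of_int (k b) + of_bool (p b)" if "b < N" for b by metis
  obtain l where l: "(\<Sum>i<4 * N. x i) = 2 * of_int l" using x by (auto simp: W_def)
  have "(\<Sum>i<4 * N. x i) = (\<Sum>b<N. 2 * of_int (k b) + of_bool (p b))"
    unfolding sum_blk by (rule sum.cong) (use k in auto)
  also have "\<dots> = of_int (2 * (\<Sum>b<N. k b) + (\<Sum>b<N. of_bool (p b)))"
    by (simp add: sum.distrib sum_distrib_left)
  finally have "of_int (2 * l) = (of_int (2 * (\<Sum>b<N. k b) + (\<Sum>b<N. of_bool (p b))) :: real)"
    using l by simp
  then have "2 * l = 2 * (\<Sum>b<N. k b) + (\<Sum>b<N. of_bool (p b))" by (simp only: of_int_eq_iff)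
  then have "even (\<Sum>b<N. of_bool (p b) :: int)" by presburger
  then show "x \<in> vecs (4 * N) \<and>
    (\<exists>h p. (\<forall>b<N. blk b x \<in> D4_coset (h, p b)) \<and> even (\<Sum>b<N. of_bool (p b) :: int))"
    using x p by (auto simp: W_def)
next
  assume R: "x \<in> vecs (4 * N) \<and>
    (\<exists>h p. (\<forall>b<N. blk b x \<in> D4_coset (h, p b)) \<and> even (\<Sum>b<N. of_bool (p b) :: int))"
  then obtain h p where p: "\<And>b. b < N \<Longrightarrow> blk b x \<in> D4_coset (h, p b)"
    and ev: "even (\<Sum>b<N. of_bool (p b) :: int)" by blast
  have hi: "x i - of_bool h / 2 \<in> \<int>" "2 * x i \<in> \<int>" if "i < 4 * N" for i
  proof -
    have b: "i div 4 < N" "i mod 4 < 4" using that by auto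
    have e: "blk (i div 4) x (i mod 4) = x i" by (simp add: blk_def)
    have "blk (i div 4) x (i mod 4) - of_bool h / 2 \<in> \<int>"
      using p[OF b(1)] b(2) by (simp add: D4_coset_def)
    then show "x i - of_bool h / 2 \<in> \<int>" unfolding e .
    show "2 * x i \<in> \<int>" using D4_coset_half_integral[OF p[OF b(1)] b(2)] e by simp
  qed
  have "x i - x 0 \<in> \<int>" if "i < 4 * N" for i
    using Ints_diff[OF hi(1)[OF that] hi(1)[of 0]] assms by simp
  have "\<exists>k::int. (\<Sum>i<4. blk b x i) = 2 * of_int k + of_bool (p b)" if "b < N" for b
    using p[OF that] by (auto simp: D4_coset_def)
  then obtain k :: "nat \<Rightarrow> int"
    where k: "(\<Sum>i<4. blk b x i) = 2 * of_int (k b) + of_bool (p b)" if "b < N" for b by metis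
  obtain l where l: "(\<Sum>b<N. of_bool (p b) :: int) = 2 * l" using ev by (rule evenE)
  have "(\<Sum>i<4 * N. x i) = (\<Sum>b<N. 2 * of_int (k b) + of_bool (p b))"
    unfolding sum_blk by (rule sum.cong) (use k in auto)
  also have "\<dots> = of_int (2 * (\<Sum>b<N. k b) + (\<Sum>b<N. of_bool (p b)))"
    by (simp add: sum.distrib sum_distrib_left)
  also have "\<dots> = 2 * of_int ((\<Sum>b<N. k b) + l)" unfolding l by simp
  finally show "x \<in> W (4 * N)"
    using R hi \<open>\<And>i. i < 4 * N \<Longrightarrow> x i - x 0 \<in> \<int>\<close> unfolding W_def by blast
qed

text \<open>For two blocks the parity condition says that both parities agree, so the coset words
  are the diagonal ones. In this form any map of D4 cosets applied to both blocks visibly preserves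
  the lattice.\<close>

lemma W_8_iff:
  "x \<in> W 8 \<longleftrightarrow> x \<in> vecs 8 \<and> (\<exists>a. blk 0 x \<in> D4_coset a \<and> blk 1 x \<in> D4_coset a)"
proof -
  have "(\<exists>h p. (\<forall>b<2. blk b x \<in> D4_coset (h, p b)) \<and> even (\<Sum>b<2. of_bool (p b) :: int)) \<longleftrightarrow>
     (\<exists>a. blk 0 x \<in> D4_coset a \<and> blk 1 x \<in> D4_coset a)" (is "?L \<longleftrightarrow> ?R")
  proof
    assume ?L
    then obtain h p where p: "\<forall>b<2. blk b x \<in> D4_coset (h, p b)" "even (\<Sum>b<2. of_bool (p b) :: int)"
      by blast
    then have "p 0 = p 1" by (cases "p 0"; cases "p 1") (auto simp: numeral_2_eq_2)
    then show ?R using p(1)[rule_format, of 0] p(1)[rule_format, of 1] by auto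
  next
    assume ?R
    then obtain h q where "blk 0 x \<in> D4_coset (h, q)" "blk 1 x \<in> D4_coset (h, q)" by auto
    then show ?L by (intro exI[of _ h] exI[of _ "\<lambda>_. q"]) (auto simp: numeral_2_eq_2 less_Suc_eq)
  qed
  then show ?thesis using W_blk_iff[of 2 x] by simp
qed

text \<open>Three parities are free and the fourth makes their number even. Each word arises from
  exactly one quadruple, so sums over words become sums over a finite type.\<close>

definition D16_word :: "bool \<times> bool \<times> bool \<times> bool \<Rightarrow> (bool \<times> bool) list" where
  "D16_word = (\<lambda>(h, p, q, r). [(h, p), (h, q), (h, r), (h, p \<noteq> (q \<noteq> r))])"

lemma all_less_4: "(\<forall>b<4. P b) \<longleftrightarrow> P 0 \<and> P 1 \<and> P 2 \<and> P (3::nat)"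
  by (auto simp: eval_nat_numeral less_Suc_eq)

lemma W_16_iff:
  "x \<in> W 16 \<longleftrightarrow> x \<in> vecs 16 \<and> (\<exists>w. \<forall>b<4. blk b x \<in> D4_coset (D16_word w ! b))"
proof -
  have "(\<exists>h p. (\<forall>b<4. blk b x \<in> D4_coset (h, p b)) \<and> even (\<Sum>b<4. of_bool (p b) :: int)) \<longleftrightarrow>
     (\<exists>w. \<forall>b<4. blk b x \<in> D4_coset (D16_word w ! b))" (is "?L \<longleftrightarrow> ?R")
  proof
    assume ?L
    then obtain h p where p: "\<forall>b<4. blk b x \<in> D4_coset (h, p b)" "even (\<Sum>b<4. of_bool (p b) :: int)"
      by blast
    then have "p 3 = (p 0 \<noteq> (p 1 \<noteq> p 2))"
      by (cases "p 0"; cases "p 1"; cases "p 2"; cases "p 3") (auto simp: sum4)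
    then have "\<forall>b<4. blk b x \<in> D4_coset (D16_word (h, p 0, p 1, p 2) ! b)"
      using p(1) by (auto simp: all_less_4 D16_word_def)
    then show ?R by blast
  next
    assume ?R
    then obtain h p q r where w: "\<forall>b<4. blk b x \<in> D4_coset (D16_word (h, p, q, r) ! b)" by auto
    show ?L
      by (rule exI[of _ h], rule exI[of _ "\<lambda>b. [p, q, r, p \<noteq> (q \<noteq> r)] ! b"])
         (use w in \<open>auto simp: all_less_4 D16_word_def sum4\<close>)
  qed
  then show ?thesis using W_blk_iff[of 4 x] by simp
qed

section \<open>An F4-invariant harmonic polynomial\<close>

text \<open>Up to a scalar, this is the only harmonic sextic in four variables invariant under
  permutations and sign changes; it is also invariant under the reflection of D4.\<close>

definition F4_sextic :: "(nat \<Rightarrow> real) \<Rightarrow> real" where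
  "F4_sextic u = u 0 ^ 6 + u 1 ^ 6 + u 2 ^ 6 + u 3 ^ 6
     - 5 * (u 0 ^ 4 * (u 1 ^ 2 + u 2 ^ 2 + u 3 ^ 2) + u 1 ^ 4 * (u 0 ^ 2 + u 2 ^ 2 + u 3 ^ 2)
          + u 2 ^ 4 * (u 0 ^ 2 + u 1 ^ 2 + u 3 ^ 2) + u 3 ^ 4 * (u 0 ^ 2 + u 1 ^ 2 + u 2 ^ 2))
     + 30 * (u 0 ^ 2 * u 1 ^ 2 * u 2 ^ 2 + u 0 ^ 2 * u 1 ^ 2 * u 3 ^ 2
          + u 0 ^ 2 * u 2 ^ 2 * u 3 ^ 2 + u 1 ^ 2 * u 2 ^ 2 * u 3 ^ 2)"

lemma F4_sextic_flip: "F4_sextic (D4_flip u) = F4_sextic u"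
  by (simp add: F4_sextic_def D4_flip_def)

lemma F4_sextic_refl: "F4_sextic (D4_refl u) = F4_sextic u"
proof -
  \<comment> \<open>Halving the coordinates clears the denominators of the reflection, which leaves
    an identity of integral polynomials.\<close>
  define a b c d where "a = u 0 / 2" and "b = u 1 / 2" and "c = u 2 / 2" and "d = u 3 / 2"
  have u: "u 0 = 2 * a" "u 1 = 2 * b" "u 2 = 2 * c" "u 3 = 2 * d"
    by (simp_all add: a_def b_def c_def d_def)
  have r: "D4_refl u 0 = a - b - c - d" "D4_refl u 1 = b - a - c - d"
    "D4_refl u 2 = c - a - b - d" "D4_refl u 3 = d - a - b - c"
    by (simp_all add: D4_refl_def sum4 a_def b_def c_def d_def field_simps)
  show ?thesis unfolding F4_sextic_def r u by algebra
qed

text \<open>The sextic has 4 pure, 12 mixed and 4 triple monomials, with coefficients 1, -5 and 30.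
  Hence its sum vanishes exactly when the hypothesis of \<open>cond_C_6\<close> holds: in every
  dimension this one polynomial in four variables decides the degree 6 condition.\<close>

lemma sum_F4_sextic:
  assumes "D_invariant n X" "4 \<le> n"
  shows "(\<Sum>x\<in>X. F4_sextic x) =
    4 * (power_sum X 6 0 0 - 15 * power_sum X 4 2 0 + 30 * power_sum X 2 2 2)"
proof -
  have 6: "(\<Sum>x\<in>X. x i ^ 6) = power_sum X 6 0 0" if "i < 4" for i
    using D_invariant_sum_one[OF assms(1), of i "\<lambda>t. t ^ 6"] assms that by (simp add: power_sum_def)
  have 42: "(\<Sum>x\<in>X. x i ^ 4 * x j ^ 2) = power_sum X 4 2 0" if "i < 4" "j < 4" "i \<noteq> j" for i j
    using D_invariant_sum_two[OF assms(1), of i j "\<lambda>s t. s ^ 4 * t ^ 2"] assms that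
    by (simp add: power_sum_def)
  have 222: "(\<Sum>x\<in>X. x i ^ 2 * x j ^ 2 * x k ^ 2) = power_sum X 2 2 2"
    if "i < 4" "j < 4" "k < 4" "distinct [i, j, k]" for i j k
    using D_invariant_sum_three[OF assms(1), of i j k "\<lambda>r s t. r ^ 2 * s ^ 2 * t ^ 2"] assms that
    by (simp add: power_sum_def)
  show ?thesis
    unfolding F4_sextic_def sum.distrib sum_subtractf sum_distrib_left[symmetric] distrib_left
    by (simp add: 6 42 222 sum.distrib sum_distrib_left[symmetric] del: One_nat_def)
qed

section \<open>Shells of W 8\<close>

lemma D_invariant_shell_W: "D_invariant n (shell n (W n) m)"
  unfolding W_eq_W_coset by (rule D_invariant_shell)

definition W8_refl :: "(nat \<Rightarrow> real) \<Rightarrow> nat \<Rightarrow> real" where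
  "W8_refl x = on_blk 0 D4_refl (on_blk 1 D4_refl x)"

lemma blk_W8_refl: "b < 2 \<Longrightarrow> blk b (W8_refl x) = D4_refl (blk b x)"
  by (auto simp: W8_refl_def blk_on_blk D4_refl_vecs numeral_2_eq_2 less_Suc_eq)

lemma W8_refl_vecs: "x \<in> vecs 8 \<Longrightarrow> W8_refl x \<in> vecs 8"
  using on_blk_vecs[of _ 2] by (simp add: W8_refl_def)

lemma inner_blk_8: "inner_n 8 x x = inner_n 4 (blk 0 x) (blk 0 x) + inner_n 4 (blk 1 x) (blk 1 x)"
  using inner_blk[of 2 x] by (simp add: numeral_2_eq_2)

text \<open>Both blocks lie in the same coset, and the reflection moves that coset in the same way
  in each block, so they still agree afterwards.\<close>

lemma W8_refl_shell:
  assumes "x \<in> shell 8 (W 8) m"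
  shows "W8_refl x \<in> shell 8 (W 8) m"
proof -
  obtain h p where hp: "blk 0 x \<in> D4_coset (h, p)" "blk 1 x \<in> D4_coset (h, p)"
    using assms by (auto simp: shell_def W_8_iff)
  then have "W8_refl x \<in> W 8"
    using assms D4_refl_coset[of _ h p] by (auto simp: shell_def W_8_iff blk_W8_refl W8_refl_vecs)
  moreover have "inner_n 8 (W8_refl x) (W8_refl x) = inner_n 8 x x"
    by (simp add: inner_blk_8 blk_W8_refl inner_D4_refl)
  ultimately show ?thesis using assms by (simp add: shell_def)
qed

lemma W8_refl_refl:
  assumes "x \<in> vecs 8"
  shows "W8_refl (W8_refl x) = x"
  by (rule vecs_blk_eqI[of _ 2]) (use assms in \<open>auto simp: W8_refl_vecs blk_W8_refl D4_refl_refl\<close>)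

lemma sum_W8_refl: "(\<Sum>x\<in>shell 8 (W 8) m. f (W8_refl x)) = (\<Sum>x\<in>shell 8 (W 8) m. f x)"
  by (rule sum.reindex_bij_witness[where i = W8_refl and j = W8_refl])
     (auto simp: W8_refl_shell, auto simp: W8_refl_refl shell_def W_def)

lemma W8_refl_0: "W8_refl x 0 = (x 0 - x 1 - x 2 - x 3) / 2"
proof -
  have "W8_refl x 0 = blk 0 (W8_refl x) 0" by (simp add: blk_def)
  also have "\<dots> = (x 0 - x 1 - x 2 - x 3) / 2"
    by (subst blk_W8_refl) (simp_all add: D4_refl_def sum4 blk_def field_simps)
  finally show ?thesis .
qed

text \<open>Coordinate 4 does not occur in the summand, so pairing it with 1, 2 or 3 makes the signs
  of these three independent. The eight sign choices therefore have equal sums.\<close>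

lemma D_invariant_sum_signs:
  fixes f :: "real \<Rightarrow> real"
  assumes "D_invariant n X" "5 \<le> n"
  shows "8 * (\<Sum>x\<in>X. f (x 0 - x 1 - x 2 - x 3)) =
   (\<Sum>x\<in>X. f (x 0 + x 1 + x 2 + x 3) + f (x 0 + x 1 + x 2 - x 3) + f (x 0 + x 1 - x 2 + x 3)
      + f (x 0 + x 1 - x 2 - x 3) + f (x 0 - x 1 + x 2 + x 3) + f (x 0 - x 1 + x 2 - x 3)
      + f (x 0 - x 1 - x 2 + x 3) + f (x 0 - x 1 - x 2 - x 3))"
proof -
  have 1: "(\<Sum>x\<in>X. g (x 0) (x 1) (x 2) (x 3)) = (\<Sum>x\<in>X. g (x 0) (- x 1) (x 2) (x 3))"
    for g :: "real \<Rightarrow> real \<Rightarrow> real \<Rightarrow> real \<Rightarrow> real"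
    using D_invariant_sum_flip[OF assms(1), of 1 4 "\<lambda>x. g (x 0) (x 1) (x 2) (x 3)"] assms by simp
  have 2: "(\<Sum>x\<in>X. g (x 0) (x 1) (x 2) (x 3)) = (\<Sum>x\<in>X. g (x 0) (x 1) (- x 2) (x 3))"
    for g :: "real \<Rightarrow> real \<Rightarrow> real \<Rightarrow> real \<Rightarrow> real"
    using D_invariant_sum_flip[OF assms(1), of 2 4 "\<lambda>x. g (x 0) (x 1) (x 2) (x 3)"] assms by simp
  have 3: "(\<Sum>x\<in>X. g (x 0) (x 1) (x 2) (x 3)) = (\<Sum>x\<in>X. g (x 0) (x 1) (x 2) (- x 3))"
    for g :: "real \<Rightarrow> real \<Rightarrow> real \<Rightarrow> real \<Rightarrow> real"
    using D_invariant_sum_flip[OF assms(1), of 3 4 "\<lambda>x. g (x 0) (x 1) (x 2) (x 3)"] assms by simp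
  have s3: "(\<Sum>x\<in>X. f (x 0 + s * x 1 + t * x 2 - x 3)) = (\<Sum>x\<in>X. f (x 0 + s * x 1 + t * x 2 + x 3))" for s t
    using 3[of "\<lambda>a b c d. f (a + s * b + t * c - d)"] by simp
  have s2: "(\<Sum>x\<in>X. f (x 0 + s * x 1 - x 2 + x 3)) = (\<Sum>x\<in>X. f (x 0 + s * x 1 + x 2 + x 3))" for s
    using 2[of "\<lambda>a b c d. f (a + s * b - c + d)"] by simp
  have s1: "(\<Sum>x\<in>X. f (x 0 - x 1 + x 2 + x 3)) = (\<Sum>x\<in>X. f (x 0 + x 1 + x 2 + x 3))"
    using 1[of "\<lambda>a b c d. f (a - b + c + d)"] by simp
  show ?thesis
    unfolding sum.distrib
    using s1 s2[of 1] s2[of "- 1"] s3[of 1 1] s3[of 1 "- 1"] s3[of "- 1" 1] s3[of "- 1" "- 1"] by simp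
qed

text \<open>Summing over signs kills the monomials with an odd exponent and multiplies the others by
  8.\<close>

lemma signed_fourth_powers:
  fixes a b c d :: real
  shows "(a + b + c + d)^4 + (a + b + c - d)^4 + (a + b - c + d)^4 + (a + b - c - d)^4
    + (a - b + c + d)^4 + (a - b + c - d)^4 + (a - b - c + d)^4 + (a - b - c - d)^4
    = 8 * (a^4 + b^4 + c^4 + d^4) + 48 * (a^2 * b^2 + a^2 * c^2 + a^2 * d^2
       + b^2 * c^2 + b^2 * d^2 + c^2 * d^2)"
  by algebra

lemma signed_sixth_powers:
  fixes a b c d :: real
  shows "(a + b + c + d)^6 + (a + b + c - d)^6 + (a + b - c + d)^6 + (a + b - c - d)^6
    + (a - b + c + d)^6 + (a - b + c - d)^6 + (a - b - c + d)^6 + (a - b - c - d)^6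
    = 8 * (a^6 + b^6 + c^6 + d^6)
      + 120 * (a^4 * b^2 + a^4 * c^2 + a^4 * d^2 + b^4 * a^2 + b^4 * c^2 + b^4 * d^2
             + c^4 * a^2 + c^4 * b^2 + c^4 * d^2 + d^4 * a^2 + d^4 * b^2 + d^4 * c^2)
      + 720 * (a^2 * b^2 * c^2 + a^2 * b^2 * d^2 + a^2 * c^2 * d^2 + b^2 * c^2 * d^2)"
  by algebra

text \<open>Write S_abc for the power sums. Invariance under the reflection gives S_4 = 3 S_22 and
  S_6 = 3 S_42 + 6 S_222. Constancy of the norm, combined with the first of these, gives S_6 + 7
  S_42 = 3 (2 S_42 + 6 S_222). The sextic relation is 4 times the second minus 3 times the
  third.\<close>

lemma W8_power_sums:
  fixes m :: real
  defines "X \<equiv> shell 8 (W 8) m"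
  shows "power_sum X 4 0 0 = 3 * power_sum X 2 2 0"
    and "power_sum X 6 0 0 - 15 * power_sum X 4 2 0 + 30 * power_sum X 2 2 2 = 0"
proof -
  have X: "D_invariant 8 X" unfolding X_def by (rule D_invariant_shell_W)
  have n: "5 \<le> (8::nat)" by simp
  have one: "(\<Sum>x\<in>X. x i ^ k) = power_sum X k 0 0" if "i < 8" for i k
    using D_invariant_sum_one[OF X that, of "\<lambda>t. t ^ k"] by (simp add: power_sum_def)
  have two: "(\<Sum>x\<in>X. x i ^ k * x j ^ l) = power_sum X k l 0" if "i < 8" "j < 8" "i \<noteq> j" for i j k l
    using D_invariant_sum_two[OF X that, of "\<lambda>s t. s ^ k * t ^ l"] by (simp add: power_sum_def)
  have three: "(\<Sum>x\<in>X. x i ^ k * x j ^ l * x r ^ q) = power_sum X k l q"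
    if "i < 8" "j < 8" "r < 8" "distinct [i, j, r]" for i j k l r q
    using D_invariant_sum_three[OF X, of i j r "\<lambda>r s t. r ^ k * s ^ l * t ^ q"] that
    by (simp add: power_sum_def)
  have "16 * (\<Sum>x\<in>X. x 0 ^ 4) = (\<Sum>x\<in>X. (x 0 - x 1 - x 2 - x 3) ^ 4)"
    unfolding X_def by (subst sum_W8_refl[symmetric])
      (simp add: W8_refl_0 power_divide sum_divide_distrib[symmetric])
  \<comment> \<open>The factor 8 replaces the sum by that over all eight sign choices, where only
    even monomials survive.\<close>
  also have "8 * \<dots> = 8 * (4 * power_sum X 4 0 0 + 36 * power_sum X 2 2 0)"
    unfolding D_invariant_sum_signs[OF X n, of "\<lambda>t. t ^ 4"] signed_fourth_powers
    by (simp add: one two sum.distrib sum_distrib_left[symmetric] del: One_nat_def)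
  finally show S4: "power_sum X 4 0 0 = 3 * power_sum X 2 2 0" using one[of 0 4] by simp
  have "64 * (\<Sum>x\<in>X. x 0 ^ 6) = (\<Sum>x\<in>X. (x 0 - x 1 - x 2 - x 3) ^ 6)"
    unfolding X_def by (subst sum_W8_refl[symmetric])
      (simp add: W8_refl_0 power_divide sum_divide_distrib[symmetric])
  also have "8 * \<dots> = 8 * (4 * power_sum X 6 0 0 + 180 * power_sum X 4 2 0 + 360 * power_sum X 2 2 2)"
    unfolding D_invariant_sum_signs[OF X n, of "\<lambda>t. t ^ 6"] signed_sixth_powers
    by (simp add: one two three sum.distrib sum_distrib_left[symmetric] del: One_nat_def)
  finally have S6: "64 * power_sum X 6 0 0 =
      4 * power_sum X 6 0 0 + 180 * power_sum X 4 2 0 + 360 * power_sum X 2 2 2"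
    using one[of 0 6] by simp
  have sum8: "(\<Sum>i<8. g i) = g 0 + g 1 + g 2 + g 3 + g 4 + g 5 + g 6 + (g 7 :: real)" for g :: "nat \<Rightarrow> real"
    by (simp add: eval_nat_numeral)
  \<comment> \<open>Multiplying a quartic monomial by the constant norm expresses sextic power sums
    through quartic ones; it is applied to x_0^4 and x_0^2 x_1^2.\<close>
  have norm: "(\<Sum>x\<in>X. (\<Sum>i<8. x i ^ 2 * g x)) = m * (\<Sum>x\<in>X. g x)" for g :: "(nat \<Rightarrow> real) \<Rightarrow> real"
  proof -
    have "(\<Sum>i<8. x i ^ 2 * g x) = m * g x" if "x \<in> X" for x
      using that unfolding X_def shell_def inner_n_def
      by (simp add: sum_distrib_right[symmetric] power2_eq_square)
    then show ?thesis by (simp add: sum_distrib_left)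
  qed
  have "(\<Sum>x\<in>X. x i ^ 2 * x 0 ^ 4) = power_sum X 4 2 0" if "i < 8" "i \<noteq> 0" for i
    using two[of 0 i 4 2] that by (simp add: mult.commute)
  moreover have "(\<Sum>x\<in>X. x 0 ^ 2 * x 0 ^ 4) = power_sum X 6 0 0"
    using one[of 0 6] by (simp flip: power_add)
  ultimately have N4: "power_sum X 6 0 0 + 7 * power_sum X 4 2 0 = m * power_sum X 4 0 0"
    using norm[of "\<lambda>x. x 0 ^ 4"] one[of 0 4]
    by (simp add: sum8 sum.distrib del: One_nat_def)
  have "(\<Sum>x\<in>X. x i ^ 2 * (x 0 ^ 2 * x 1 ^ 2)) = power_sum X 2 2 2" if "i < 8" "i \<noteq> 0" "i \<noteq> 1" for i
    using three[of i 0 1 2 2 2] that by (simp add: mult.assoc)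
  moreover have "(\<Sum>x\<in>X. x 0 ^ 2 * (x 0 ^ 2 * x 1 ^ 2)) = power_sum X 4 2 0"
    using two[of 0 1 4 2] by (simp flip: power_add mult.assoc)
  moreover have "(\<Sum>x\<in>X. x 1 ^ 2 * (x 0 ^ 2 * x 1 ^ 2)) = power_sum X 4 2 0"
  proof -
    have "(\<Sum>x\<in>X. x 1 ^ 2 * (x 0 ^ 2 * x 1 ^ 2)) = (\<Sum>x\<in>X. x 1 ^ 4 * x 0 ^ 2)"
      by (rule sum.cong) (simp_all add: power2_eq_square power4_eq_xxxx mult_ac)
    then show ?thesis using two[of 1 0 4 2] by simp
  qed
  ultimately have N22: "2 * power_sum X 4 2 0 + 6 * power_sum X 2 2 2 = m * power_sum X 2 2 0"
    using norm[of "\<lambda>x. x 0 ^ 2 * x 1 ^ 2"] two[of 0 1 2 2]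
    by (simp add: sum8 sum.distrib del: One_nat_def)
  have "power_sum X 6 0 0 + 7 * power_sum X 4 2 0 = 3 * (2 * power_sum X 4 2 0 + 6 * power_sum X 2 2 2)"
    unfolding N4 N22 S4 by simp
  with S6 show "power_sum X 6 0 0 - 15 * power_sum X 4 2 0 + 30 * power_sum X 2 2 2 = 0" by simp
qed

lemma W8_sum_F4_sextic: "(\<Sum>x\<in>shell 8 (W 8) m. F4_sextic x) = 0"
  using sum_F4_sextic[OF D_invariant_shell_W, of 8 m] W8_power_sums(2)[of m] by simp

section \<open>Shells of W 16\<close>

definition word_shell :: "real \<Rightarrow> (bool \<times> bool) list \<Rightarrow> (nat \<Rightarrow> real) set" where
  "word_shell m w = {x \<in> vecs 16. inner_n 16 x x = m \<and> (\<forall>b<4. blk b x \<in> D4_coset (w ! b))}"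

definition word_sum :: "real \<Rightarrow> (bool \<times> bool) list \<Rightarrow> real" where
  "word_sum m w = (\<Sum>x\<in>word_shell m w. F4_sextic x)"

lemma F4_sextic_blk: "F4_sextic (blk 0 x) = F4_sextic x"
proof -
  have "blk 0 x 0 = x 0" "blk 0 x 1 = x 1" "blk 0 x 2 = x 2" "blk 0 x 3 = x 3"
    unfolding blk_def by (simp_all add: numeral_2_eq_2)
  then show ?thesis unfolding F4_sextic_def by (simp only:)
qed

lemma inner_blk_16: "inner_n 16 x x = (\<Sum>b<4. inner_n 4 (blk b x) (blk b x))"
  using inner_blk[of 4 x] by simp

lemma finite_word_shell: "finite (word_shell m w)"
proof (rule finite_subset[OF _ finite_half_integral_sphere[of 16 m]])
  show "word_shell m w \<subseteq> {x \<in> vecs 16. (\<forall>i<16. 2 * x i \<in> \<int>) \<and> inner_n 16 x x = m}"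
  proof (intro subsetI CollectI conjI allI impI)
    fix x i assume x: "x \<in> word_shell m w" and i: "i < (16::nat)"
    then have "blk (i div 4) x \<in> D4_coset (w ! (i div 4))" by (auto simp: word_shell_def)
    then have "2 * blk (i div 4) x (i mod 4) \<in> \<int>" by (rule D4_coset_half_integral) simp
    then show "2 * x i \<in> \<int>" by (simp add: blk_def)
  qed (auto simp: word_shell_def)
qed

text \<open>Applying the involutive isometry \<open>g\<close> to block \<open>b\<close> matches the
  two shells. The sextic reads only block 0: it is unchanged by \<open>F4\<close> if
  \<open>b = 0\<close>, and because block 0 is untouched otherwise.\<close>

lemma word_sum_on_blk:
  assumes b: "b < 4" and len: "length w = 4"
    and vecs: "\<And>u. u \<in> vecs 4 \<Longrightarrow> g u \<in> vecs 4"
    and inv: "\<And>u. u \<in> vecs 4 \<Longrightarrow> g (g u) = u"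
    and inner: "\<And>u. inner_n 4 (g u) (g u) = inner_n 4 u u"
    and F4: "\<And>u. F4_sextic (g u) = F4_sextic u"
    and coset: "\<And>u. u \<in> D4_coset (w ! b) \<Longrightarrow> g u \<in> D4_coset a"
      "\<And>u. u \<in> D4_coset a \<Longrightarrow> g u \<in> D4_coset (w ! b)"
  shows "word_sum m (w[b := a]) = word_sum m w"
proof -
  note [simp] = blk_on_blk[of g, OF vecs]
  have v: "on_blk b g x \<in> vecs 16" if "x \<in> vecs 16" for x
    using on_blk_vecs[of b 4 x g] b that by simp
  have i: "inner_n 16 (on_blk b g x) (on_blk b g x) = inner_n 16 x x" for x
    unfolding inner_blk_16 by (rule sum.cong) (auto simp: inner)
  have s: "on_blk b g (on_blk b g x) = x" if "x \<in> vecs 16" for x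
    by (rule vecs_blk_eqI[of _ 4]) (use that v in \<open>auto simp: inv\<close>)
  show ?thesis
    unfolding word_sum_def
  proof (rule sum.reindex_bij_witness[where i = "on_blk b g" and j = "on_blk b g"])
    fix x assume x: "x \<in> word_shell m (w[b := a])"
    then have xb: "blk c x \<in> D4_coset (w[b := a] ! c)" if "c < 4" for c
      using that by (simp add: word_shell_def)
    have "blk c (on_blk b g x) \<in> D4_coset (w ! c)" if "c < 4" for c
      using xb[OF that] b len coset(2) by (auto simp: nth_list_update)
    then show "on_blk b g x \<in> word_shell m w" using x v i by (simp add: word_shell_def del: blk_on_blk)
    show "on_blk b g (on_blk b g x) = x" using x s by (simp add: word_shell_def)
    have "F4_sextic (blk 0 (on_blk b g x)) = F4_sextic (blk 0 x)" by (simp add: F4)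
    then show "F4_sextic (on_blk b g x) = F4_sextic x" by (simp only: F4_sextic_blk)
  next
    fix x assume x: "x \<in> word_shell m w"
    then have xb: "blk c x \<in> D4_coset (w ! c)" if "c < 4" for c
      using that by (simp add: word_shell_def)
    have "blk c (on_blk b g x) \<in> D4_coset (w[b := a] ! c)" if "c < 4" for c
      using xb[OF that] b len coset(1) by (auto simp: nth_list_update)
    then show "on_blk b g x \<in> word_shell m (w[b := a])"
      using x v i by (simp add: word_shell_def del: blk_on_blk)
    show "on_blk b g (on_blk b g x) = x" using x s by (simp add: word_shell_def)
  qed
qed

lemma word_sum_refl:
  assumes "b < 4" "length w = 4" "w ! b = (h, p)"
  shows "word_sum m (w[b := (h \<noteq> p, p)]) = word_sum m w"
proof (rule word_sum_on_blk[OF assms(1,2) D4_refl_vecs D4_refl_refl inner_D4_refl F4_sextic_refl])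
  show "D4_refl u \<in> D4_coset (h \<noteq> p, p)" if "u \<in> D4_coset (w ! b)" for u
    using D4_refl_coset that assms(3) by simp
  show "D4_refl u \<in> D4_coset (w ! b)" if "u \<in> D4_coset (h \<noteq> p, p)" for u
    using D4_refl_coset[OF that] assms(3) by (cases h; cases p) auto
qed

lemma word_sum_flip:
  assumes "b < 4" "length w = 4" "w ! b = (h, p)"
  shows "word_sum m (w[b := (h, p \<noteq> h)]) = word_sum m w"
proof (rule word_sum_on_blk[OF assms(1,2) D4_flip_vecs D4_flip_flip inner_D4_flip F4_sextic_flip])
  show "D4_flip u \<in> D4_coset (h, p \<noteq> h)" if "u \<in> D4_coset (w ! b)" for u
    using D4_flip_coset that assms(3) by simp
  show "D4_flip u \<in> D4_coset (w ! b)" if "u \<in> D4_coset (h, p \<noteq> h)" for u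
    using D4_flip_coset[OF that] assms(3) by (cases h; cases p) auto
qed

text \<open>Triality: the two block maps permute the three nontrivial cosets transitively, so only the
  positions of the trivial coset matter.\<close>

lemma word_sum_triality:
  assumes "b < 4" "length w = 4" "w ! b = (h, p)"
  shows "word_sum m (w[b := (False, h \<or> p)]) = word_sum m w"
proof (cases h)
  case False
  then show ?thesis using assms list_update_id[of w b] by simp
next
  case True
  \<comment> \<open>The reflection reaches \<open>(False, True)\<close> only from
    \<open>(True, True)\<close>, so \<open>(True, False)\<close> is first sent there by the
    flip.\<close>
  have TT: "word_sum m (v[b := (False, True)]) = word_sum m v"
    if "length v = 4" "v ! b = (True, True)" for v
    using word_sum_refl[OF assms(1) that, of m] by simp
  show ?thesis
  proof (cases p)
    case p: True
    then show ?thesis using TT[of w] True assms by simp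
  next
    case p: False
    have "word_sum m (w[b := (True, True)]) = word_sum m w"
      using word_sum_flip[OF assms, of m] True p by simp
    moreover have "word_sum m ((w[b := (True, True)])[b := (False, True)]) = word_sum m (w[b := (True, True)])"
      by (rule TT) (use assms in auto)
    ultimately show ?thesis using True by simp
  qed
qed

text \<open>A flag says whether the block lies in a nontrivial coset; \<open>(False, True)\<close>
  is the chosen representative of the three.\<close>

definition zero_pattern_sum :: "real \<Rightarrow> bool \<Rightarrow> bool \<Rightarrow> bool \<Rightarrow> bool \<Rightarrow> real" where
  "zero_pattern_sum m a b c d = word_sum m [(False, a), (False, b), (False, c), (False, d)]"

lemma word_sum_zero_pattern:
  "word_sum m [(h0, p0), (h1, p1), (h2, p2), (h3, p3)] =
   zero_pattern_sum m (h0 \<or> p0) (h1 \<or> p1) (h2 \<or> p2) (h3 \<or> p3)"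
proof -
  have "word_sum m [(h0, p0), (h1, p1), (h2, p2), (h3, p3)]
      = word_sum m [(False, h0 \<or> p0), (h1, p1), (h2, p2), (h3, p3)]"
    using word_sum_triality[of 0 "[(h0, p0), (h1, p1), (h2, p2), (h3, p3)]" h0 p0 m] by simp
  also have "\<dots> = word_sum m [(False, h0 \<or> p0), (False, h1 \<or> p1), (h2, p2), (h3, p3)]"
    using word_sum_triality[of 1 "[(False, h0 \<or> p0), (h1, p1), (h2, p2), (h3, p3)]" h1 p1 m] by simp
  also have "\<dots> = word_sum m [(False, h0 \<or> p0), (False, h1 \<or> p1), (False, h2 \<or> p2), (h3, p3)]"
    using word_sum_triality[of 2 "[(False, h0 \<or> p0), (False, h1 \<or> p1), (h2, p2), (h3, p3)]" h2 p2 m]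
    by (simp add: numeral_2_eq_2)
  also have "\<dots> = zero_pattern_sum m (h0 \<or> p0) (h1 \<or> p1) (h2 \<or> p2) (h3 \<or> p3)"
    using word_sum_triality[of 3 "[(False, h0 \<or> p0), (False, h1 \<or> p1), (False, h2 \<or> p2), (h3, p3)]" h3 p3 m]
    by (simp add: numeral_3_eq_3 zero_pattern_sum_def)
  finally show ?thesis .
qed

text \<open>Permuting whole blocks is an isometry, and it preserves the sextic as long as block 0
  stays in place; hence the restriction to the blocks 1, 2, 3.\<close>

lemma word_sum_permute_blocks:
  assumes s: "s permutes {1..<4}"
    and w: "\<And>b. b < 4 \<Longrightarrow> w' ! b = w ! s b"
  shows "word_sum m w' = word_sum m w"
proof -
  have s4: "s b < 4" if "b < 4" for b
    using permutes_in_image[OF s, of b] permutes_not_in[OF s, of b] that by (cases "b = 0") auto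
  have s4': "4 \<le> s b" if "4 \<le> b" for b
    using permutes_not_in[OF s, of b] that by simp
  have s0: "s 0 = 0" using permutes_not_in[OF s, of 0] by simp
  have inv: "s (inv s b) = b" "inv s (s b) = b" for b
    using permutes_inverses[OF s] by auto
  have t: "inv s permutes {1..<4}" by (rule permutes_inv[OF s])
  have t4: "inv s b < 4" if "b < 4" for b
    using permutes_in_image[OF t, of b] permutes_not_in[OF t, of b] that by (cases "b = 0") auto
  have t4': "4 \<le> inv s b" if "4 \<le> b" for b
    using permutes_not_in[OF t, of b] that by simp
  define P where "P = (\<lambda>(s :: nat \<Rightarrow> nat) (x :: nat \<Rightarrow> real) i. x (4 * s (i div 4) + i mod 4))"
  have blkP: "blk b (P s x) = blk (s b) x" for b s x
    by (auto simp: blk_def P_def fun_eq_iff)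
  have vP: "P r x \<in> vecs 16" if xv: "x \<in> vecs 16" and r: "\<And>b. 4 \<le> b \<Longrightarrow> 4 \<le> r b" for x r
  proof -
    have "P r x i = 0" if i: "16 \<le> i" for i
    proof -
      have "4 \<le> i div 4" using i by simp
      then have "4 \<le> r (i div 4)" by (rule r)
      then show ?thesis using xv by (simp add: P_def vecs_def)
    qed
    then show ?thesis by (simp add: vecs_def)
  qed
  have PP: "P s (P (inv s) x) = x" "P (inv s) (P s x) = x" for x
    by (auto simp: P_def inv fun_eq_iff)
  have iP: "inner_n 16 (P s x) (P s x) = inner_n 16 x x" for x
  proof -
    have "s permutes {..<4}" using s by (rule permutes_subset) auto
    from sum.permute[OF this, of "\<lambda>b. inner_n 4 (blk b x) (blk b x)"]
    show ?thesis by (simp add: inner_blk_16 blkP)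
  qed
  have "(\<Sum>x\<in>word_shell m w. F4_sextic x) = (\<Sum>x\<in>word_shell m w'. F4_sextic x)"
  proof (rule sum.reindex_bij_witness[where i = "P (inv s)" and j = "P s"])
    fix x assume x: "x \<in> word_shell m w"
    show "P (inv s) (P s x) = x" by (rule PP)
    show "P s x \<in> word_shell m w'"
      using x s4 by (auto simp: word_shell_def vP s4' iP blkP w)
    show "F4_sextic (P s x) = F4_sextic x"
      using blkP[of 0 s x] s0 F4_sextic_blk by metis
  next
    fix x assume x: "x \<in> word_shell m w'"
    show "P s (P (inv s) x) = x" by (rule PP)
    have "inner_n 16 (P (inv s) x) (P (inv s) x) = m"
      using iP[of "P (inv s) x"] x by (simp add: PP word_shell_def)
    moreover have "blk b (P (inv s) x) \<in> D4_coset (w ! b)" if "b < 4" for b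
      using x t4[OF that] w[OF t4[OF that]] by (auto simp: word_shell_def blkP inv)
    ultimately show "P (inv s) x \<in> word_shell m w"
      using x by (auto simp: word_shell_def vP t4')
  qed
  then show ?thesis by (simp add: word_sum_def)
qed

lemma zero_pattern_sum_swap:
  "zero_pattern_sum m a b c d = zero_pattern_sum m a c b d"
  "zero_pattern_sum m a b c d = zero_pattern_sum m a b d c"
proof -
  show "zero_pattern_sum m a b c d = zero_pattern_sum m a c b d"
    unfolding zero_pattern_sum_def
    by (rule word_sum_permute_blocks[of "transpose 1 2"])
       (auto intro!: permutes_swap_id simp: transpose_def numeral_eq_Suc less_Suc_eq)
  show "zero_pattern_sum m a b c d = zero_pattern_sum m a b d c"
    unfolding zero_pattern_sum_def
    by (rule word_sum_permute_blocks[of "transpose 2 3"])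
       (auto intro!: permutes_swap_id simp: transpose_def numeral_eq_Suc less_Suc_eq)
qed

section \<open>Comparison with the sum of two copies of \<open>W 8\<close>\<close>

definition E8E8_word :: "bool \<times> bool \<times> bool \<times> bool \<Rightarrow> (bool \<times> bool) list" where
  "E8E8_word = (\<lambda>(h, p, h', p'). [(h, p), (h, p), (h', p'), (h', p')])"

text \<open>In both families one word is entirely trivial and nine have no trivial block. The
  remaining six have two nontrivial blocks, three of them with block 0 trivial and three with block
  0 nontrivial. Permuting the blocks 1, 2, 3 makes the sums within each class equal.\<close>

lemma word_sum_D16_eq_E8E8:
  "(\<Sum>w\<in>UNIV. word_sum m (D16_word w)) = (\<Sum>w\<in>UNIV. word_sum m (E8E8_word w))"
proof -
  have UNIV_prod: "(\<Sum>w\<in>UNIV. f w) = (\<Sum>h\<in>UNIV. \<Sum>p\<in>UNIV. \<Sum>q\<in>UNIV. \<Sum>r\<in>UNIV. f (h, p, q, r))"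
    for f :: "bool \<times> bool \<times> bool \<times> bool \<Rightarrow> real"
    by (simp add: sum.cartesian_product)
  have 1: "zero_pattern_sum m a False True False = zero_pattern_sum m a True False False"
    "zero_pattern_sum m a False False True = zero_pattern_sum m a True False False"
    "zero_pattern_sum m a True False True = zero_pattern_sum m a True True False"
    "zero_pattern_sum m a False True True = zero_pattern_sum m a True True False" for a
    using zero_pattern_sum_swap(1)[of m a False True False] zero_pattern_sum_swap(2)[of m a False False True]
      zero_pattern_sum_swap(2)[of m a True False True] zero_pattern_sum_swap(1)[of m a False True True]
    by simp_all
  show ?thesis
    unfolding UNIV_prod by (simp add: UNIV_bool D16_word_def E8E8_word_def word_sum_zero_pattern 1)
qed

text \<open>Uniqueness of the coset of each block makes the shells of distinct words
  disjoint.\<close>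

lemma sum_word_union:
  assumes "\<And>w w'. \<forall>b<4. c w ! b = c w' ! b \<Longrightarrow> w = w'"
  shows "(\<Sum>x\<in>(\<Union>w::bool \<times> bool \<times> bool \<times> bool. word_shell m (c w)). F4_sextic x) = (\<Sum>w\<in>UNIV. word_sum m (c w))"
  unfolding word_sum_def
proof (rule sum.UNION_disjoint)
  show "\<forall>w\<in>UNIV. \<forall>w'\<in>UNIV. w \<noteq> w' \<longrightarrow> word_shell m (c w) \<inter> word_shell m (c w') = {}"
  proof (intro ballI impI, rule ccontr)
    fix w w' assume "w \<noteq> w'" "word_shell m (c w) \<inter> word_shell m (c w') \<noteq> {}"
    then obtain x where "x \<in> word_shell m (c w)" "x \<in> word_shell m (c w')" by blast
    then have "\<forall>b<4. c w ! b = c w' ! b" unfolding word_shell_def using D4_coset_unique by blast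
    with assms \<open>w \<noteq> w'\<close> show False by blast
  qed
qed (auto simp: finite_word_shell)

lemma W16_shell_word: "shell 16 (W 16) m = (\<Union>w. word_shell m (D16_word w))"
  by (auto simp: shell_def W_16_iff word_shell_def)

text \<open>The shell is sliced by its last eight coordinates z. On each slice the first eight range
  over the shell of \<open>W 8\<close> of norm m minus that of z; the sextic depends only on them
  and sums to zero there.\<close>

lemma E8E8_sum_F4_sextic: "(\<Sum>x\<in>(\<Union>w. word_shell m (E8E8_word w)). F4_sextic x) = 0"
proof -
  define S where "S = (\<Union>w. word_shell m (E8E8_word w))"
  define tail where "tail = (\<lambda>(x :: nat \<Rightarrow> real) i. x (8 + i))"
  define join where "join = (\<lambda>(y :: nat \<Rightarrow> real) (z :: nat \<Rightarrow> real) i. if i < 8 then y i else z (i - 8))"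
  define head where "head = (\<lambda>(x :: nat \<Rightarrow> real) i. if i < 8 then x i else 0)"
  have b: "blk 0 (head x) = blk 0 x" "blk 1 (head x) = blk 1 x"
    "blk 0 (tail x) = blk 2 x" "blk 1 (tail x) = blk 3 x" for x
    by (auto simp: blk_def head_def tail_def fun_eq_iff)
  have S: "x \<in> S \<longleftrightarrow> x \<in> vecs 16 \<and> inner_n 16 x x = m \<and> head x \<in> W 8 \<and> tail x \<in> W 8" for x
  proof -
    have v: "head x \<in> vecs 8" "x \<in> vecs 16 \<Longrightarrow> tail x \<in> vecs 8"
      by (auto simp: head_def tail_def vecs_def)
    show ?thesis
      unfolding S_def W_8_iff b using v
      by (auto simp: word_shell_def E8E8_word_def all_less_4)
  qed
  have fin: "finite S" unfolding S_def by (auto simp: finite_word_shell)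
  have inner: "inner_n 16 x x = inner_n 8 (head x) (head x) + inner_n 8 (tail x) (tail x)" for x
    by (simp add: inner_blk_16 inner_blk_8 b sum4 del: One_nat_def)
  have slice: "(\<Sum>x\<in>{x. x \<in> S \<and> tail x = z}. F4_sextic x) = 0" if "z \<in> tail ` S" for z
  proof -
    have z: "z \<in> W 8" using that S by auto
    have hj: "head (join y z) = y" if "y \<in> vecs 8" for y
      using that by (auto simp: head_def join_def vecs_def fun_eq_iff)
    have tj: "tail (join y z) = z" for y by (auto simp: tail_def join_def)
    have jv: "join y z \<in> vecs 16" for y using z by (auto simp: join_def vecs_def W_def)
    have "(\<Sum>x\<in>{x. x \<in> S \<and> tail x = z}. F4_sextic x) =
        (\<Sum>y\<in>shell 8 (W 8) (m - inner_n 8 z z). F4_sextic y)"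
    proof (rule sum.reindex_bij_witness[where i = "\<lambda>y. join y z" and j = head])
      fix x assume x: "x \<in> {x. x \<in> S \<and> tail x = z}"
      then have "z (i - 8) = x i" if "8 \<le> i" for i using that by (auto simp: tail_def)
      then show "join (head x) z = x" by (auto simp: join_def head_def fun_eq_iff)
      show "head x \<in> shell 8 (W 8) (m - inner_n 8 z z)"
        using x S[of x] inner[of x] by (auto simp: shell_def)
      show "F4_sextic (head x) = F4_sextic x" by (simp add: F4_sextic_def head_def)
    next
      fix y assume y: "y \<in> shell 8 (W 8) (m - inner_n 8 z z)"
      then have yv: "y \<in> vecs 8" by (auto simp: shell_def W_def)
      show "head (join y z) = y" using yv by (rule hj)
      show "join y z \<in> {x. x \<in> S \<and> tail x = z}"
        using y z jv yv by (auto simp: S inner hj tj shell_def)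
    qed
    then show ?thesis using W8_sum_F4_sextic by simp
  qed
  have "(\<Sum>x\<in>S. F4_sextic x) = (\<Sum>z\<in>tail ` S. \<Sum>x\<in>{x. x \<in> S \<and> tail x = z}. F4_sextic x)"
    by (rule sum.group[symmetric]) (auto simp: fin)
  also have "\<dots> = 0" by (rule sum.neutral) (use slice in auto)
  finally show ?thesis unfolding S_def .
qed

lemma W16_sum_F4_sextic: "(\<Sum>x\<in>shell 16 (W 16) m. F4_sextic x) = 0"
proof -
  have "(\<Sum>x\<in>shell 16 (W 16) m. F4_sextic x) = (\<Sum>w\<in>UNIV. word_sum m (D16_word w))"
    unfolding W16_shell_word
    by (rule sum_word_union) (auto simp: D16_word_def all_less_4)
  also have "\<dots> = (\<Sum>w\<in>UNIV. word_sum m (E8E8_word w))" by (rule word_sum_D16_eq_E8E8)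
  also have "\<dots> = (\<Sum>x\<in>(\<Union>w. word_shell m (E8E8_word w)). F4_sextic x)"
    by (rule sum_word_union[symmetric]) (auto simp: E8E8_word_def all_less_4)
  also have "\<dots> = 0" by (rule E8E8_sum_F4_sextic)
  finally show ?thesis .
qed

section \<open>The design properties of the shells\<close>

lemma spherical_3_design_shell:
  assumes "3 \<le> n"
  shows "spherical_design n 3 (shell n (W_coset n e) m)"
  unfolding spherical_design_def
proof (intro allI impI)
  fix j :: nat assume "2 \<le> 2 * j \<and> 2 * j \<le> 3"
  then have "2 * j = 2" by presburger
  then show "cond_C n (2 * j) (shell n (W_coset n e) m)"
    using cond_C_2[OF D_invariant_shell assms] by simp
qed

lemma W8_spherical_7_design: "spherical_design 8 7 (shell 8 (W 8) m)"
  unfolding spherical_design_def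
proof (intro allI impI)
  fix j :: nat assume "2 \<le> 2 * j \<and> 2 * j \<le> 7"
  then have "2 * j = 2 \<or> 2 * j = 4 \<or> 2 * j = 6" by presburger
  then consider "2 * j = 2" | "2 * j = 4" | "2 * j = 6" by blast
  then show "cond_C 8 (2 * j) (shell 8 (W 8) m)"
  proof cases
    case 1
    show ?thesis unfolding 1 by (rule cond_C_2[OF D_invariant_shell_W]) simp
  next
    case 2
    show ?thesis unfolding 2 by (rule cond_C_4[OF D_invariant_shell_W _ W8_power_sums(1)]) simp
  next
    case 3
    show ?thesis unfolding 3 by (rule cond_C_6[OF D_invariant_shell_W _ W8_power_sums(2)]) simp
  qed
qed

lemma W16_spherical_half_design: "spherical_half_design 16 1 (shell 16 (W 16) m)"
  unfolding spherical_half_design_def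
proof (intro conjI allI impI)
  fix j :: nat assume "2 \<le> 2 * j \<and> 2 * j \<le> 2 * 1"
  then have j: "2 * j = 2" by presburger
  show "cond_C 16 (2 * j) (shell 16 (W 16) m)"
    unfolding j by (rule cond_C_2[OF D_invariant_shell_W]) simp
next
  have "cond_C 16 6 (shell 16 (W 16) m)"
    by (rule cond_C_6[OF D_invariant_shell_W])
       (use sum_F4_sextic[OF D_invariant_shell_W, of 16 m] W16_sum_F4_sextic[of m] in auto)
  then show "cond_C 16 (2 * 1 + 4) (shell 16 (W 16) m)" by simp
qed

theorem theorem10p2:
  shows "(\<forall>n m. 8 \<le> n \<and> 4 dvd n \<longrightarrow>
            (shell n (W n) m \<noteq> {} \<longrightarrow> spherical_design n 3 (shell n (W n) m)) \<and>
            (shell n (ShW n) m \<noteq> {} \<longrightarrow> spherical_design n 3 (shell n (ShW n) m)))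
       \<and> (\<forall>m. shell 8 (W 8) m \<noteq> {} \<longrightarrow> spherical_design 8 7 (shell 8 (W 8) m))
       \<and> (\<forall>m. shell 16 (W 16) m \<noteq> {} \<longrightarrow> spherical_half_design 16 1 (shell 16 (W 16) m))"
  using W8_spherical_7_design W16_spherical_half_design spherical_3_design_shell
  by (simp add: W_eq_W_coset[of n for n] ShW_eq_W_coset)

end
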